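(* Let $\mathcal{M}$ be a moon polyomino with $m$ columns $c_1,\dots,c_m$ from left to right, let $\mathbf{s}=(s_1,\dots,s_m)$ be an $m$-tuple of nonnegative integers and let $A$ be a subset of the rows of $\mathcal{M}$. Let $a_i$ be the number of rows in $A$ that intersect the column $c_i$, let $c_{i_1}\prec c_{i_2}\prec\cdots\prec c_{i_m}$ be the ordering of the columns under the total order $\prec$, and for $j=1,\dots,m$ put $$h_{i_j}=|c_{i_j}|-a_{i_j}-(s_{i_1}+s_{i_2}+\cdots+s_{i_{j-1}}).$$ Then $$\sum_{M\in\mathbf{F}(\mathcal{M},\mathbf{s};A)}q^{\mathrm{maj}(M)}=\prod_{i=1}^{m}\binom{h_i}{s_i}_q ,$$ where $\binom{h}{s}_q$ denotes the $q$-binomial coefficient.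
   Context: **Polyominoes.** A polyomino is a finite subset of $\mathbb{Z}^2$ whose elements are drawn as square cells. It is convex if its intersection with any row or column is connected, and intersection-free if any two of its columns are comparable, i.e. the set of row-coordinates of one is contained in that of the other (equivalently, any two rows are comparable). A moon polyomino is a convex intersection-free polyomino. $|c|$ denotes the length (number of cells) of a column $c$. **Fillings.** A filling of a moon polyomino $\mathcal{M}$ assigns $0$ or $1$ to each cell with at most one $1$ in each row; a 1-cell is a cell assigned $1$; a row is empty if it contains no 1-cell. $\mathbf{F}(\mathcal{M},\mathbf{s};A)$ is the set of fillings of $\mathcal{M}$ whose empty rows are exactly those in $A$ and in which column $c_i$ has exactly $s_i$ 1's for each $i$. An NE chain is a pair of 1-cells, one strictly above and strictly to the right of the other, such that the smallest rectangle containing them is contained in $\mathcal{M}$. **Major index.** For a filling $R$ of a rectangle with nonempty rows $r_1,\dots,r_n$ from top to bottom, $\mathrm{des}(R)$ is the number of $i$ such that the 1-cells of $r_i$ and $r_{i+1}$ form an NE chain; $R(r_i)$ is the restriction of $R$ to the row $r_i$ and all rows above it; and $\mathrm{maj}(R)=\sum_{i=1}^n\mathrm{des}(R(r_i))$. For a filling $M$ of a moon polyomino $\mathcal{M}$, let $\mathcal{R}_1,\dots,\mathcal{R}_r$ be all the maximal rectangles contained in $\mathcal{M}$, ordered increasingly by height, and $R_i$ the restriction of $M$ to $\mathcal{R}_i$. Then $\mathrm{maj}(M)=\sum_{i=1}^r\mathrm{maj}(R_i)-\sum_{i=1}^{r-1}\mathrm{maj}(R_i\cap R_{i+1})$, where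 $R_i\cap R_{i+1}$ is the restriction of $M$ to $\mathcal{R}_i\cap\mathcal{R}_{i+1}$. **The order $\prec$.** There is a unique $k$ with $|c_1|\le\cdots\le|c_{k-1}|<|c_k|\ge|c_{k+1}|\ge\cdots\ge|c_m|$. Let $Left(\mathcal{M})=\{c_1,\dots,c_{k-1}\}$, $Right(\mathcal{M})=\{c_k,\dots,c_m\}$. Then $c_i\prec c_j$ iff $|c_i|<|c_j|$; or $|c_i|=|c_j|$, $c_i\in Left(\mathcal{M})$ and $c_j\in Right(\mathcal{M})$; or $|c_i|=|c_j|$, both are in $Left(\mathcal{M})$ and $c_i$ is to the left of $c_j$; or $|c_i|=|c_j|$, both are in $Right(\mathcal{M})$ and $c_i$ is to the right of $c_j$.
   Formalization: Proved assuming that s_1+...+s_m is at least the number of rows of M not in A; without this the identity can fail (one column of length 2, A empty, s_1=1 gives 0 on the left and 1+q on the right). *)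

theory Defs
  imports "HOL-Computational_Algebra.Formal_Laurent_Series"
begin

section \<open>Moon polyominoes\<close>

text \<open>A cell is a point \<open>(x, y)\<close> of the integer grid; \<open>x\<close> is its column and grows to the right,
  \<open>y\<close> is its row and grows upwards.\<close>

type_synonym cell = "int \<times> int"

definition column :: "cell set \<Rightarrow> int \<Rightarrow> int set" where
  "column P x = {y. (x, y) \<in> P}"

definition row :: "cell set \<Rightarrow> int \<Rightarrow> int set" where
  "row P y = {x. (x, y) \<in> P}"

definition rows :: "cell set \<Rightarrow> int set" where
  "rows P = snd ` P"

definition contiguous :: "int set \<Rightarrow> bool" where
  "contiguous S \<longleftrightarrow> (\<forall>a\<in>S. \<forall>b\<in>S. {a..b} \<subseteq> S)"

definition convex_polyomino :: "cell set \<Rightarrow> bool" where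
  "convex_polyomino P \<longleftrightarrow> (\<forall>x. contiguous (column P x)) \<and> (\<forall>y. contiguous (row P y))"

definition intersection_free :: "cell set \<Rightarrow> bool" where
  "intersection_free P \<longleftrightarrow>
     (\<forall>x x'. column P x \<subseteq> column P x' \<or> column P x' \<subseteq> column P x)"

definition moon_polyomino :: "cell set \<Rightarrow> bool" where
  "moon_polyomino P \<longleftrightarrow> finite P \<and> convex_polyomino P \<and> intersection_free P"

text \<open>The nonempty columns are numbered \<open>1, \<dots>, ncols P\<close> from left to right; \<open>col P i\<close> is the
  set of row-coordinates of the \<open>i\<close>-th one. Its value is irrelevant for other \<open>i\<close>.\<close>

definition ncols :: "cell set \<Rightarrow> nat" where
  "ncols P = card (fst ` P)"

definition col_coord :: "cell set \<Rightarrow> nat \<Rightarrow> int" where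
  "col_coord P i = sorted_list_of_set (fst ` P) ! (i - 1)"

definition col :: "cell set \<Rightarrow> nat \<Rightarrow> int set" where
  "col P i = column P (col_coord P i)"

definition col_len :: "cell set \<Rightarrow> nat \<Rightarrow> nat" where
  "col_len P i = card (col P i)"


section \<open>The order on the columns\<close>

definition is_peak :: "cell set \<Rightarrow> nat \<Rightarrow> bool" where
  "is_peak P k \<longleftrightarrow> k \<in> {1..ncols P} \<and>
     (\<forall>i. 1 \<le> i \<and> i + 1 < k \<longrightarrow> col_len P i \<le> col_len P (i + 1)) \<and>
     (1 < k \<longrightarrow> col_len P (k - 1) < col_len P k) \<and>
     (\<forall>i. k \<le> i \<and> i < ncols P \<longrightarrow> col_len P i \<ge> col_len P (i + 1))"

definition peak :: "cell set \<Rightarrow> nat" where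
  "peak P = (THE k. is_peak P k)"

definition left_cols :: "cell set \<Rightarrow> nat set" where
  "left_cols P = {1..<peak P}"

definition right_cols :: "cell set \<Rightarrow> nat set" where
  "right_cols P = {peak P..ncols P}"

definition col_prec :: "cell set \<Rightarrow> nat \<Rightarrow> nat \<Rightarrow> bool" where
  "col_prec P i j \<longleftrightarrow>
     col_len P i < col_len P j \<or>
     col_len P i = col_len P j \<and> i \<in> left_cols P \<and> j \<in> right_cols P \<or>
     col_len P i = col_len P j \<and> i \<in> left_cols P \<and> j \<in> left_cols P \<and> i < j \<or>
     col_len P i = col_len P j \<and> i \<in> right_cols P \<and> j \<in> right_cols P \<and> j < i"


section \<open>Fillings\<close>

text \<open>A 01-filling is represented by its set of 1-cells, so that restricting a filling to a
  subset of the cells is intersection.\<close>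

definition is_filling :: "cell set \<Rightarrow> cell set \<Rightarrow> bool" where
  "is_filling P M \<longleftrightarrow> M \<subseteq> P \<and> (\<forall>y\<in>rows P. card (row M y) \<le> 1)"

definition empty_rows :: "cell set \<Rightarrow> cell set \<Rightarrow> int set" where
  "empty_rows P M = {y \<in> rows P. row M y = {}}"

definition fillings :: "cell set \<Rightarrow> (nat \<Rightarrow> nat) \<Rightarrow> int set \<Rightarrow> cell set set" where
  "fillings P s A = {M. is_filling P M \<and> empty_rows P M = A \<and>
     (\<forall>i\<in>{1..ncols P}. card (column M (col_coord P i)) = s i)}"

text \<open>\<open>NE_chain P M a b\<close>: the upper right cell of the chain is \<open>b\<close>.\<close>

definition NE_chain :: "cell set \<Rightarrow> cell set \<Rightarrow> cell \<Rightarrow> cell \<Rightarrow> bool" where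
  "NE_chain P M a b \<longleftrightarrow> a \<in> M \<and> b \<in> M \<and> fst a < fst b \<and> snd a < snd b \<and>
     {fst a..fst b} \<times> {snd a..snd b} \<subseteq> P"


section \<open>Major index\<close>

text \<open>The nonempty rows of \<open>M\<close> listed from top to bottom, hence by decreasing coordinate.\<close>

definition nonempty_rows :: "cell set \<Rightarrow> int list" where
  "nonempty_rows M = rev (sorted_list_of_set (snd ` M))"

text \<open>In \<open>des\<close> and \<open>maj_rect\<close>, \<open>R\<close> is a rectangle and \<open>M\<close> a filling of \<open>R\<close>. The list of nonempty
  rows is indexed from \<open>0\<close>.\<close>

definition des :: "cell set \<Rightarrow> cell set \<Rightarrow> nat" where
  "des R M = (let r = nonempty_rows M in
     card {i. i + 1 < length r \<and> (\<exists>x x'. NE_chain R M (x', r ! (i + 1)) (x, r ! i))})"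

definition from_row_up :: "int \<Rightarrow> cell set" where
  "from_row_up y0 = {(x, y). y0 \<le> y}"

definition maj_rect :: "cell set \<Rightarrow> cell set \<Rightarrow> nat" where
  "maj_rect R M = (let r = nonempty_rows M in
     \<Sum>i<length r. des (R \<inter> from_row_up (r ! i)) (M \<inter> from_row_up (r ! i)))"

definition is_rectangle :: "cell set \<Rightarrow> bool" where
  "is_rectangle R \<longleftrightarrow> (\<exists>a b c d. a \<le> b \<and> c \<le> d \<and> R = {a..b} \<times> {c..d})"

definition max_rectangles :: "cell set \<Rightarrow> cell set set" where
  "max_rectangles P = {R. is_rectangle R \<and> R \<subseteq> P \<and>
     (\<forall>R'. is_rectangle R' \<and> R' \<subseteq> P \<and> R \<subseteq> R' \<longrightarrow> R' = R)}"

definition height :: "cell set \<Rightarrow> nat" where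
  "height R = card (rows R)"

text \<open>Distinct maximal rectangles of a moon polyomino have distinct heights, so their ordering by
  height is unique.\<close>

definition max_rectangle_list :: "cell set \<Rightarrow> cell set list" where
  "max_rectangle_list P =
     (THE Rs. set Rs = max_rectangles P \<and> sorted_wrt (\<lambda>R R'. height R < height R') Rs)"

definition maj :: "cell set \<Rightarrow> cell set \<Rightarrow> int" where
  "maj P M = (let R = max_rectangle_list P; r = length R in
     (\<Sum>i<r. int (maj_rect (R ! i) (M \<inter> R ! i))) -
     (\<Sum>i<r - 1. int (maj_rect (R ! i \<inter> R ! (i + 1)) (M \<inter> (R ! i \<inter> R ! (i + 1))))))"


section \<open>Gaussian binomial coefficients\<close>

definition q_int :: "'a::field \<Rightarrow> nat \<Rightarrow> 'a" where
  "q_int q n = (\<Sum>i<n. q ^ i)"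

definition q_fact :: "'a::field \<Rightarrow> nat \<Rightarrow> 'a" where
  "q_fact q n = (\<Prod>i=1..n. q_int q i)"

text \<open>Intended for a \<open>q\<close> that is not a root of unity, in particular for an indeterminate. The
  upper argument is an integer, and the coefficient is zero unless \<open>0 \<le> k \<le> n\<close>.\<close>

definition q_binomial :: "'a::field \<Rightarrow> int \<Rightarrow> nat \<Rightarrow> 'a" where
  "q_binomial q n k =
     (if int k \<le> n then q_fact q (nat n) / (q_fact q k * q_fact q (nat n - k)) else 0)"

text \<open>The indeterminate. Laurent series are used so that \<open>q\<close> can be raised to the power \<open>maj P M\<close>,
  which is defined as a difference.\<close>

abbreviation q_indet :: "rat fls" where
  "q_indet \<equiv> fls_X"

end

theory Submission
  imports Defs
begin

text \<open>Let \<open>x\<^sub>1, \<dots>, x\<^sub>m\<close> be the columns in the order \<open>\<prec>\<close>, so that their sets of rows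
  \<open>C\<^sub>1 \<subseteq> \<dots> \<subseteq> C\<^sub>m\<close> increase and each \<open>x\<^sub>j\<close> lies either to the left or to the right of all its
  successors. The maximal rectangles are the \<open>X\<^sub>C \<times> C\<close>, where \<open>C\<close> is the row set of a column and
  \<open>X\<^sub>C\<close> consists of the columns that contain \<open>C\<close>. Hence the alternating sum defining \<open>maj M\<close> is
  refined by the telescoping sum of the differences
  \<open>maj ({x\<^sub>j, \<dots>, x\<^sub>m} \<times> C\<^sub>j) - maj ({x\<^sub>j\<^sub>+\<^sub>1, \<dots>, x\<^sub>m} \<times> C\<^sub>j)\<close> over \<open>j\<close>.

  Read a filling as the word of the column coordinates of its 1-cells, from top to bottom. The rows
  of \<open>C\<^sub>1\<close> form a window of this word, and deleting the letter \<open>x\<^sub>1\<close> gives a word of the same kind for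
  the remaining columns. Conversely, the \<open>s\<^sub>1\<close> copies of \<open>x\<^sub>1\<close> can be inserted anywhere in the window.
  As \<open>x\<^sub>1\<close> is smaller or larger than all other letters, summing over these insertions multiplies
  \<open>q\<close> to the power of the major index by a Gaussian binomial coefficient. Induction on \<open>m\<close> concludes.\<close>

section \<open>Gaussian binomial coefficients\<close>

text \<open>The coefficient \<open>n + k\<close> over \<open>k\<close>: with this indexing no recurrence involves subtraction.\<close>

definition gauss :: "'a::field \<Rightarrow> nat \<Rightarrow> nat \<Rightarrow> 'a" where
  "gauss q n k = q_fact q (n + k) / (q_fact q n * q_fact q k)"

lemma q_binomial_eq_gauss: "q_binomial q (int (n + k)) k = gauss q n k"
  by (simp add: q_binomial_def gauss_def mult.commute flip: of_nat_add)

lemma q_fact_0 [simp]: "q_fact q 0 = 1"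
  by (simp add: q_fact_def)

lemma q_fact_Suc: "q_fact q (Suc n) = q_int q (Suc n) * q_fact q n"
  by (simp add: q_fact_def mult.commute)

lemma q_int_add: "q_int q (m + n) = q_int q m + q ^ m * q_int q n"
proof -
  have "q_int q (m + n) = (\<Sum>i<m. q ^ i) + (\<Sum>i=m..<m + n. q ^ i)"
    by (simp add: q_int_def lessThan_atLeast0 sum.atLeastLessThan_concat)
  also have "(\<Sum>i=m..<m + n. q ^ i) = q ^ m * (\<Sum>i<n. q ^ i)"
    using sum.shift_bounds_nat_ivl[of "\<lambda>i. q ^ i" 0 m n]
    by (simp add: sum_distrib_left power_add lessThan_atLeast0 add.commute mult.commute)
  finally show ?thesis by (simp add: q_int_def)
qed

text \<open>Nonvanishing q-integers make all q-factorials invertible. A nonzero \<open>q\<close> is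
  required because the major index enters as an integer exponent and sums of exponents must turn
  into products.\<close>

locale q_analog =
  fixes q :: "'a::field"
  assumes q_nonzero: "q \<noteq> 0"
    and q_int_nonzero: "q_int q (Suc n) \<noteq> 0"
begin

lemma q_fact_nonzero: "q_fact q n \<noteq> 0"
  by (induction n) (simp_all add: q_fact_Suc q_int_nonzero)

lemma gauss_0_left [simp]: "gauss q 0 k = 1"
  by (simp add: gauss_def q_fact_nonzero)

lemma gauss_0_right [simp]: "gauss q n 0 = 1"
  by (simp add: gauss_def q_fact_nonzero)

text \<open>The leading q-integer of the numerator splits as
  \<open>q_int q (Suc k) + q ^ Suc k * q_int q (Suc n)\<close>, and each summand cancels one factor
  of the denominator.\<close>

lemma gauss_Pascal_right:
  "gauss q (Suc n) (Suc k) = gauss q (Suc n) k + q ^ Suc k * gauss q n (Suc k)"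
proof -
  define F where "F = q_fact q (Suc n + k)"
  have "q_fact q (Suc n + Suc k) = (q_int q (Suc k) + q ^ Suc k * q_int q (Suc n)) * F"
    using q_int_add[of q "Suc k" "Suc n"] by (simp add: q_fact_Suc F_def add.commute)
  moreover have "gauss q (Suc n) k = F / (q_fact q (Suc n) * q_fact q k)"
    "gauss q n (Suc k) = F / (q_fact q n * q_fact q (Suc k))"
    by (simp_all add: gauss_def F_def)
  ultimately show ?thesis
    by (simp add: gauss_def q_fact_Suc q_fact_nonzero q_int_nonzero divide_simps)
       (auto simp: algebra_simps)
qed

lemma gauss_commute: "gauss q n k = gauss q k n"
  by (simp add: gauss_def add.commute mult.commute)

lemma gauss_Pascal_left:
  "gauss q (Suc n) (Suc k) = q ^ Suc n * gauss q (Suc n) k + gauss q n (Suc k)"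
  using gauss_Pascal_right[of k n] by (simp add: gauss_commute add.commute)

end

section \<open>Inserting an extremal letter into a word\<close>

text \<open>A descent weighs the number of letters after its first letter, which is how often \<open>maj_rect\<close>
  counts it when the rows are read from top to bottom.\<close>

fun word_maj :: "'a::linorder list \<Rightarrow> nat" where
  "word_maj (a # b # w) = (if b < a then Suc (length w) else 0) + word_maj (b # w)"
| "word_maj w = 0"

text \<open>Encoded as a fibre of the map that deletes \<open>x\<close>, so that sums over words can
  be grouped by the word that remains. The set is empty when \<open>x\<close> occurs in
  \<open>w\<close>.\<close>

definition insertions :: "'a \<Rightarrow> nat \<Rightarrow> 'a list \<Rightarrow> 'a list set" where
  "insertions x s w = {v. filter (\<lambda>a. a \<noteq> x) v = w \<and> count_list v x = s}"

lemma length_eq_filter_count: "length v = length (filter (\<lambda>a. a \<noteq> x) v) + count_list v x"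
  by (induction v) auto

lemma length_insertions: "v \<in> insertions x s w \<Longrightarrow> length v = length w + s"
  using length_eq_filter_count[of v x] by (simp add: insertions_def)

lemma finite_insertions: "finite (insertions x s w)"
proof (rule finite_subset)
  show "insertions x s w \<subseteq> {v. set v \<subseteq> insert x (set w) \<and> length v = length w + s}"
    using length_insertions[of _ x s w] by (auto simp: insertions_def)
qed (simp add: finite_lists_length_eq)

lemma filter_neq_id: "x \<notin> set w \<Longrightarrow> filter (\<lambda>a. a \<noteq> x) w = w"
  by (auto simp: filter_id_conv)

lemma insertions_0: "x \<notin> set w \<Longrightarrow> insertions x 0 w = {w}"
  by (auto simp: insertions_def count_list_0_iff filter_neq_id)

lemma filter_neq_Nil: "filter (\<lambda>a. a \<noteq> x) v = [] \<longleftrightarrow> v = replicate (count_list v x) x"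
proof
  assume "filter (\<lambda>a. a \<noteq> x) v = []"
  then show "v = replicate (count_list v x) x"
    by (induction v) (auto split: if_splits)
next
  assume "v = replicate (count_list v x) x"
  then have "set v \<subseteq> {x}" by (metis set_replicate_conv_if empty_subsetI order_refl)
  then show "filter (\<lambda>a. a \<noteq> x) v = []" by (auto simp: filter_empty_conv)
qed

lemma count_list_replicate [simp]: "count_list (replicate n x) x = n"
  by (induction n) auto

lemma insertions_Nil: "insertions x s [] = {replicate s x}"
  by (auto simp: insertions_def filter_neq_Nil)

lemma insertions_Cons:
  assumes "a \<noteq> x"
  shows "insertions x (Suc s) (a # w) =
    (#) x ` insertions x s (a # w) \<union> (#) a ` insertions x (Suc s) w"
proof (intro set_eqI iffI)
  fix v assume "v \<in> insertions x (Suc s) (a # w)"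
  then show "v \<in> (#) x ` insertions x s (a # w) \<union> (#) a ` insertions x (Suc s) w"
    by (cases v) (auto simp: insertions_def split: if_splits)
qed (use assms in \<open>auto simp: insertions_def\<close>)

lemma sum_insertions_Cons:
  assumes "a \<noteq> x"
  shows "sum g (insertions x (Suc s) (a # w)) =
    (\<Sum>v\<in>insertions x s (a # w). g (x # v)) + (\<Sum>v\<in>insertions x (Suc s) w. g (a # v))"
  unfolding insertions_Cons[OF assms]
  by (subst sum.union_disjoint) (use assms in \<open>auto simp: finite_insertions sum.reindex\<close>)

lemma word_maj_replicate [simp]: "word_maj (replicate s x) = 0"
proof (induction s)
  case (Suc s) then show ?case by (cases s) auto
qed auto

lemma word_maj_Cons_replicate:
  "word_maj (a # replicate s x) = (if x < a then s else 0)"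
  using word_maj_replicate[of s x] by (cases s) auto

lemma word_maj_Cons_le: "(\<And>b. b \<in> set v \<Longrightarrow> x \<le> b) \<Longrightarrow> word_maj (x # v) = word_maj v"
  by (cases v) (auto simp: not_less)

lemma set_insertions: "v \<in> insertions x s w \<Longrightarrow> set v \<subseteq> insert x (set w)"
  by (auto simp: insertions_def)

context q_analog
begin

text \<open>The second conjunct, with a letter in front, is what makes the induction go through.\<close>

lemma sum_insert_min:
  assumes "\<forall>b\<in>set w. x < b"
  shows "(\<Sum>v\<in>insertions x s w. q ^ word_maj v) = q ^ word_maj w * gauss q (length w) s
    \<and> (\<forall>a>x. (\<Sum>v\<in>insertions x s w. q ^ word_maj (a # v)) =
          q ^ (word_maj (a # w) + s) * gauss q (length w) s)"
  using assms
proof (induction w arbitrary: s)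
  case Nil
  then show ?case by (simp add: insertions_Nil word_maj_Cons_replicate)
next
  case (Cons b w)
  from Cons.prems have b: "x < b" "b \<noteq> x" and w: "x \<notin> set (b # w)" by auto
  have IH: "(\<Sum>v\<in>insertions x s w. q ^ word_maj (b # v)) =
          q ^ (word_maj (b # w) + s) * gauss q (length w) s" for s
    using Cons b by simp
  \<comment> \<open>Inner induction on \<open>s\<close>: a leading \<open>x\<close> is minimal and
    starts no descent, while a leading \<open>b\<close> gives the sum in \<open>IH\<close>. The two
    cases add up by \<open>gauss_Pascal_right\<close>.\<close>
  have A: "(\<Sum>v\<in>insertions x s (b # w). q ^ word_maj v) =
      q ^ word_maj (b # w) * gauss q (Suc (length w)) s" for s
  proof (induction s)
    case 0
    then show ?case using w by (simp add: insertions_0)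
  next
    case (Suc s)
    have "(\<Sum>v\<in>insertions x s (b # w). q ^ word_maj (x # v)) =
        (\<Sum>v\<in>insertions x s (b # w). q ^ word_maj v)"
    proof (rule sum.cong)
      fix v assume "v \<in> insertions x s (b # w)"
      then show "q ^ word_maj (x # v) = q ^ word_maj v"
        using set_insertions[of v x s "b # w"] Cons.prems b
        by (subst word_maj_Cons_le) (auto intro: order.strict_implies_order)
    qed simp
    then show ?case
      using b by (simp add: sum_insertions_Cons Suc IH gauss_Pascal_right power_add algebra_simps)
  qed
  have B: "(\<Sum>v\<in>insertions x s (b # w). q ^ word_maj (a # v)) =
          q ^ (word_maj (a # b # w) + s) * gauss q (Suc (length w)) s" if "x < a" for a
  proof (cases s)
    case 0
    then show ?thesis using w by (simp add: insertions_0)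
  next
    case (Suc t)
    \<comment> \<open>The descent from \<open>a\<close> to \<open>x\<close> weighs
      \<open>Suc (length v)\<close>, where \<open>v\<close> has length
      \<open>Suc (length w) + t\<close> and \<open>s = Suc t\<close>.\<close>
    have "(\<Sum>v\<in>insertions x t (b # w). q ^ word_maj (a # x # v)) =
        (\<Sum>v\<in>insertions x t (b # w). q ^ (Suc (length w) + s) * q ^ word_maj v)"
    proof (rule sum.cong)
      fix v assume v: "v \<in> insertions x t (b # w)"
      then have "word_maj (x # v) = word_maj v"
        using set_insertions[of v x t "b # w"] Cons.prems b
        by (subst word_maj_Cons_le) (auto intro: order.strict_implies_order)
      then show "q ^ word_maj (a # x # v) = q ^ (Suc (length w) + s) * q ^ word_maj v"
        using that length_insertions[OF v] Suc by (simp add: power_add)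
    qed simp
    also have "\<dots> = q ^ (Suc (length w) + s) * (q ^ word_maj (b # w) * gauss q (Suc (length w)) t)"
      by (simp only: A flip: sum_distrib_left)
    finally have 1: "(\<Sum>v\<in>insertions x t (b # w). q ^ word_maj (a # x # v)) = \<dots>" .
    have "(\<Sum>v\<in>insertions x s w. q ^ word_maj (a # b # v)) =
      (\<Sum>v\<in>insertions x s w. (if b < a then q ^ (Suc (length w) + s) else 1) * q ^ word_maj (b # v))"
      by (rule sum.cong) (auto simp: length_insertions power_add)
    also have "\<dots> = (if b < a then q ^ (Suc (length w) + s) else 1) *
        (q ^ (word_maj (b # w) + s) * gauss q (length w) s)"
      by (simp only: IH flip: sum_distrib_left)
    finally have 2: "(\<Sum>v\<in>insertions x s w. q ^ word_maj (a # b # v)) = \<dots>" .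
    \<comment> \<open>Whether \<open>a\<close> followed by \<open>b\<close> is a descent decides
      which of the two Pascal recurrences combines \<open>1\<close> and \<open>2\<close>.\<close>
    show ?thesis
    proof (cases "b < a")
      case True
      then show ?thesis using b 1 2 Suc
        by (simp add: sum_insertions_Cons gauss_Pascal_right[of _ t] power_add algebra_simps)
    next
      case False
      then show ?thesis using b 1 2 Suc
        by (simp add: sum_insertions_Cons gauss_Pascal_left[of _ t] power_add algebra_simps)
    qed
  qed
  show ?case using A B by simp
qed

text \<open>The argument is dual to \<open>sum_insert_min\<close>, but a smaller letter in front
  forms no descent with an inserted \<open>x\<close>, so its sum carries no extra factor
  \<open>q ^ s\<close>. The descents now start at the inserted letters.\<close>

lemma sum_insert_max:
  assumes "\<forall>b\<in>set w. b < x"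
  shows "(\<Sum>v\<in>insertions x s w. q ^ word_maj v) = q ^ word_maj w * gauss q (length w) s
    \<and> (\<forall>a<x. (\<Sum>v\<in>insertions x s w. q ^ word_maj (a # v)) =
          q ^ word_maj (a # w) * gauss q (length w) s)"
  using assms
proof (induction w arbitrary: s)
  case Nil
  then show ?case by (auto simp add: insertions_Nil word_maj_Cons_replicate)
next
  case (Cons b w)
  from Cons.prems have b: "b < x" "b \<noteq> x" "\<not> x < b" and w: "x \<notin> set (b # w)" by auto
  have IH: "(\<Sum>v\<in>insertions x s w. q ^ word_maj (b # v)) =
          q ^ word_maj (b # w) * gauss q (length w) s" for s
    using Cons b by simp
  \<comment> \<open>This evaluates the words with a leading \<open>x\<close>, which occur in both
    \<open>A\<close> and \<open>B\<close>. Only the last \<open>x\<close> before \<open>b\<close>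
    starts a descent.\<close>
  have C: "(\<Sum>v\<in>insertions x s (b # w). q ^ word_maj (x # v)) =
      q ^ (word_maj (b # w) + Suc (length w)) * gauss q (Suc (length w)) s" for s
  proof (induction s)
    case 0
    then show ?case using w b by (simp add: insertions_0 power_add)
  next
    case (Suc s)
    have "(\<Sum>v\<in>insertions x (Suc s) w. q ^ word_maj (x # b # v)) =
        (\<Sum>v\<in>insertions x (Suc s) w. q ^ (length w + Suc (Suc s)) * q ^ word_maj (b # v))"
      using b by (intro sum.cong) (auto simp: length_insertions power_add)
    also have "\<dots> = q ^ (length w + Suc (Suc s)) * (q ^ word_maj (b # w) * gauss q (length w) (Suc s))"
      by (simp only: IH flip: sum_distrib_left)
    finally show ?case
      using b by (simp add: sum_insertions_Cons Suc gauss_Pascal_right power_add algebra_simps)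
  qed
  have A: "(\<Sum>v\<in>insertions x s (b # w). q ^ word_maj v) =
      q ^ word_maj (b # w) * gauss q (Suc (length w)) s"
  proof (cases s)
    case 0
    then show ?thesis using w by (simp add: insertions_0)
  next
    case (Suc t)
    then show ?thesis
      using b by (simp add: sum_insertions_Cons C IH gauss_Pascal_left power_add algebra_simps)
  qed
  have B: "(\<Sum>v\<in>insertions x s (b # w). q ^ word_maj (a # v)) =
          q ^ word_maj (a # b # w) * gauss q (Suc (length w)) s" if "a < x" for a
  proof (cases s)
    case 0
    then show ?thesis using w by (simp add: insertions_0)
  next
    case (Suc t)
    have 1: "(\<Sum>v\<in>insertions x t (b # w). q ^ word_maj (a # x # v)) =
      q ^ (word_maj (b # w) + Suc (length w)) * gauss q (Suc (length w)) t"
      using C[of t] that not_less_iff_gr_or_eq[of x a] by simp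
    have "(\<Sum>v\<in>insertions x s w. q ^ word_maj (a # b # v)) =
      (\<Sum>v\<in>insertions x s w. (if b < a then q ^ (Suc (length w) + s) else 1) * q ^ word_maj (b # v))"
      by (rule sum.cong) (auto simp: length_insertions power_add)
    also have "\<dots> = (if b < a then q ^ (Suc (length w) + s) else 1) *
        (q ^ word_maj (b # w) * gauss q (length w) s)"
      by (simp only: IH flip: sum_distrib_left)
    finally have 2: "(\<Sum>v\<in>insertions x s w. q ^ word_maj (a # b # v)) = \<dots>" .
    show ?thesis
    proof (cases "b < a")
      case True
      then show ?thesis using b 1 2 Suc
        by (simp add: sum_insertions_Cons gauss_Pascal_right[of _ t] power_add algebra_simps)
    next
      case False
      then show ?thesis using b 1 2 Suc
        by (simp add: sum_insertions_Cons gauss_Pascal_left[of _ t] power_add algebra_simps)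
    qed
  qed
  show ?case using A B by simp
qed

text \<open>A smallest and a largest letter give the same factor, so it does not matter for the
  product on which side of its successors a column lies.\<close>

lemma sum_insertions:
  assumes "(\<forall>b\<in>set w. x < b) \<or> (\<forall>b\<in>set w. b < x)"
  shows "(\<Sum>v\<in>insertions x s w. q ^ word_maj v) = q ^ word_maj w * gauss q (length w) s"
  using assms sum_insert_min[of w x s] sum_insert_max[of w x s] by auto

end

section \<open>Words with letters confined to windows\<close>

text \<open>Measured from both ends, a window is described by the same \<open>p\<close> and \<open>r\<close> after the deletion of
  letters inside it.\<close>

definition window :: "nat \<Rightarrow> nat \<Rightarrow> 'a list \<Rightarrow> 'a list" where
  "window p r w = drop p (take (length w - r) w)"

lemma window_append: "length u = p \<Longrightarrow> length z = r \<Longrightarrow> window p r (u @ v @ z) = v"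
  by (simp add: window_def)

lemma append_window:
  "p + r \<le> length w \<Longrightarrow> take p w @ window p r w @ drop (length w - r) w = w"
proof -
  assume "p + r \<le> length w"
  then have "take p w = take p (take (length w - r) w)" by (simp add: min_absorb1)
  then show ?thesis unfolding window_def
    by (metis append_assoc append_take_drop_id)
qed

text \<open>The telescoped major index: each letter contributes the change of
  \<open>word_maj\<close> on its window caused by its deletion. The windows of later letters are
  taken in the word that remains.\<close>

fun col_stat :: "('a::linorder \<Rightarrow> nat) \<Rightarrow> ('a \<Rightarrow> nat) \<Rightarrow> 'a list \<Rightarrow> 'a list \<Rightarrow> int" where
  "col_stat p r [] w = 0"
| "col_stat p r (x # xs) w =
     int (word_maj (window (p x) (r x) w))
     - int (word_maj (filter (\<lambda>a. a \<noteq> x) (window (p x) (r x) w)))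
     + col_stat p r xs (filter (\<lambda>a. a \<noteq> x) w)"

text \<open>With \<open>p x\<close> and \<open>r x\<close> the numbers of nonempty rows above and
  below column \<open>x\<close>, these are the words of fillings with \<open>n\<close> nonempty
  rows. The last two conditions confine each letter to its window.\<close>

definition col_words ::
  "('a \<Rightarrow> nat) \<Rightarrow> ('a \<Rightarrow> nat) \<Rightarrow> ('a \<Rightarrow> nat) \<Rightarrow> 'a list \<Rightarrow> nat \<Rightarrow> 'a list set" where
  "col_words p r s xs n = {w. length w = n \<and> set w \<subseteq> set xs \<and>
     (\<forall>x\<in>set xs. count_list w x = s x \<and>
        x \<notin> set (take (p x) w) \<and> x \<notin> set (drop (length w - r x) w))}"

fun extremal_heads :: "'a::linorder list \<Rightarrow> bool" where
  "extremal_heads [] \<longleftrightarrow> True"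
| "extremal_heads (x # xs) \<longleftrightarrow>
     ((\<forall>y\<in>set xs. x < y) \<or> (\<forall>y\<in>set xs. y < x)) \<and> extremal_heads xs"

lemma finite_col_words: "finite (col_words p r s xs n)"
proof (rule finite_subset)
  show "col_words p r s xs n \<subseteq> {w. set w \<subseteq> set xs \<and> length w = n}"
    by (auto simp: col_words_def)
qed (simp add: finite_lists_length_eq)

lemma count_list_filter_neq:
  "y \<noteq> x \<Longrightarrow> count_list (filter (\<lambda>a. a \<noteq> x) w) y = count_list w y"
  by (induction w) auto

lemma drop_length_diff_append:
  "k \<le> length z \<Longrightarrow> drop (length (v @ z) - k) (v @ z) = drop (length z - k) z"
  by simp

lemma col_words_ConsE:
  assumes "w \<in> col_words p r s (x # xs) n" "p x + r x \<le> n"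
  obtains u v z where "w = u @ v @ z" "length u = p x" "length z = r x"
    "x \<notin> set u" "x \<notin> set z" "count_list v x = s x" "length v = n - p x - r x"
proof
  let ?u = "take (p x) w" and ?v = "window (p x) (r x) w" and ?z = "drop (length w - r x) w"
  have l: "length w = n" and c: "count_list w x = s x"
    and u: "x \<notin> set ?u" and z: "x \<notin> set ?z"
    using assms(1) by (auto simp: col_words_def)
  show w: "w = ?u @ ?v @ ?z" using append_window[of "p x" "r x" w] assms(2) l by simp
  have "count_list w x = count_list ?u x + count_list ?v x + count_list ?z x"
    by (subst w) simp
  then show "count_list ?v x = s x" using c u z by simp
  show "x \<notin> set ?u" "x \<notin> set ?z" by fact+
  show "length ?u = p x" "length ?z = r x" using l assms(2) by auto
  show "length ?v = n - p x - r x" using l by (simp add: window_def)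
qed

text \<open>A letter \<open>y\<close> of \<open>xs\<close> is excluded only from the first
  \<open>p y\<close> and the last \<open>r y\<close> positions. As windows grow along the list,
  these positions lie inside \<open>u\<close> and \<open>z\<close>, which the insertion leaves
  untouched.\<close>

lemma col_words_fiber:
  assumes pr: "p x + r x + s x \<le> n" and x: "x \<notin> set xs"
    and nested: "\<forall>y\<in>set xs. p y \<le> p x \<and> r y \<le> r x"
    and w': "w' = u @ v' @ z" "length u = p x" "length z = r x"
      "w' \<in> col_words p r s xs (n - s x)"
  shows "{w \<in> col_words p r s (x # xs) n. filter (\<lambda>a. a \<noteq> x) w = w'} =
    (\<lambda>v. u @ v @ z) ` insertions x (s x) v'"
proof (intro set_eqI iffI)
  fix w assume "w \<in> {w \<in> col_words p r s (x # xs) n. filter (\<lambda>a. a \<noteq> x) w = w'}"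
  then have w: "w \<in> col_words p r s (x # xs) n" and f: "filter (\<lambda>a. a \<noteq> x) w = w'" by auto
  from w obtain u1 v z1 where "w = u1 @ v @ z1" "length u1 = p x" "length z1 = r x"
    "x \<notin> set u1" "x \<notin> set z1" "count_list v x = s x"
    by (rule col_words_ConsE) (use pr in auto)
  with f w' show "w \<in> (\<lambda>v. u @ v @ z) ` insertions x (s x) v'"
    by (auto simp: filter_neq_id insertions_def image_iff)
next
  fix w assume "w \<in> (\<lambda>v. u @ v @ z) ` insertions x (s x) v'"
  then obtain v where w: "w = u @ v @ z" and v: "v \<in> insertions x (s x) v'" by auto
  have lw': "length w' = n - s x" and sw': "set w' \<subseteq> set xs"
    using w'(4) by (auto simp: col_words_def)
  have xw': "x \<notin> set w'" using sw' x by auto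
  have f: "filter (\<lambda>a. a \<noteq> x) w = w'"
    using v w w'(1) xw' by (simp add: insertions_def filter_neq_id)
  have lv: "length v = length v' + s x" using length_insertions[OF v] .
  have "set w \<subseteq> insert x (set w')"
    unfolding f[symmetric] by auto
  moreover have "count_list w x = s x"
    using v xw' by (simp add: w w'(1) insertions_def)
  moreover have "length w = n" using lw' lv pr by (simp add: w w'(1))
  moreover have "count_list w y = s y \<and> y \<notin> set (take (p y) w) \<and> y \<notin> set (drop (length w - r y) w)"
    if y: "y \<in> set xs" for y
  proof -
    have "y \<noteq> x" using y x by auto
    then have "count_list w y = count_list w' y"
      using count_list_filter_neq f by metis
    moreover have "take (p y) w = take (p y) w'"
      using nested y by (simp add: w w'(1,2))
    moreover have "drop (length w - r y) w = drop (length w' - r y) w'"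
      using nested y drop_length_diff_append[of "r y" z "u @ v"]
        drop_length_diff_append[of "r y" z "u @ v'"] by (simp add: w w'(1,3))
    ultimately show ?thesis using w'(4) y by (auto simp: col_words_def)
  qed
  moreover have "x \<notin> set (take (p x) w)" "x \<notin> set (drop (length w - r x) w)"
    using w w'(1-3) xw' by auto
  ultimately have "w \<in> col_words p r s (x # xs) n"
    using sw' by (auto simp: col_words_def)
  with f show "w \<in> {w \<in> col_words p r s (x # xs) n. filter (\<lambda>a. a \<noteq> x) w = w'}" by simp
qed

text \<open>Deletion changes only the part between \<open>u\<close> and \<open>z\<close>, and the
  positions forbidden to the letters of \<open>xs\<close> lie in \<open>u\<close> and
  \<open>z\<close>.\<close>

lemma filter_col_words:
  assumes pr: "p x + r x \<le> n" and x: "x \<notin> set xs"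
    and nested: "\<forall>y\<in>set xs. p y \<le> p x \<and> r y \<le> r x"
    and w: "w \<in> col_words p r s (x # xs) n"
  shows "filter (\<lambda>a. a \<noteq> x) w \<in> col_words p r s xs (n - s x)"
proof -
  let ?w = "filter (\<lambda>a. a \<noteq> x) w"
  from w pr obtain u v z where e: "w = u @ v @ z" "length u = p x" "length z = r x"
    "x \<notin> set u" "x \<notin> set z"
    by (rule col_words_ConsE)
  have f: "?w = u @ filter (\<lambda>a. a \<noteq> x) v @ z"
    using e by (simp add: filter_neq_id)
  have "length ?w = n - s x"
    using length_eq_filter_count[of w x] w unfolding col_words_def by auto
  moreover have "set ?w \<subseteq> set xs" using w by (auto simp: col_words_def)
  moreover have "count_list ?w y = s y \<and> y \<notin> set (take (p y) ?w) \<and> y \<notin> set (drop (length ?w - r y) ?w)"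
    if y: "y \<in> set xs" for y
  proof -
    have "y \<noteq> x" using y x by auto
    then have "count_list ?w y = count_list w y"
      by (rule count_list_filter_neq)
    moreover have "take (p y) ?w = take (p y) w"
      unfolding f using nested y by (simp add: e(1,2))
    moreover have "drop (length ?w - r y) ?w = drop (length w - r y) w"
      unfolding f
      using nested y drop_length_diff_append[of "r y" z "u @ v"]
        drop_length_diff_append[of "r y" z "u @ filter (\<lambda>a. a \<noteq> x) v"] by (simp add: e(1,3))
    ultimately show ?thesis using w y by (auto simp: col_words_def)
  qed
  ultimately show ?thesis by (simp add: col_words_def)
qed

text \<open>Group the words by what remains after deleting the first letter. Each group consists of
  the insertions into one window of reduced length \<open>n - p x - r x - s x\<close>, and it
  contributes the same Gaussian coefficient whatever the remaining word is.\<close>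

lemma (in q_analog) sum_col_words:
  assumes "extremal_heads xs" "sorted_wrt (\<lambda>x y. p y \<le> p x \<and> r y \<le> r x) xs"
    and "\<forall>x\<in>set xs. p x + r x \<le> n" "n \<le> sum_list (map s xs)"
  shows "(\<Sum>w\<in>col_words p r s xs n. q powi col_stat p r xs w) =
    (\<Prod>j<length xs. q_binomial q
       (int n - int (p (xs ! j)) - int (r (xs ! j)) - int (\<Sum>l<j. s (xs ! l))) (s (xs ! j)))"
  using assms
proof (induction xs arbitrary: n)
  case Nil
  \<comment> \<open>The bound on \<open>n\<close> leaves no positions once all letters are used up.
    With positions left over there would be no word, although the empty product is 1.\<close>
  then have "col_words p r s [] n = {[]}" by (auto simp: col_words_def)
  then show ?case by simp
next
  case (Cons x xs)
  let ?f = "filter (\<lambda>a. a \<noteq> x)"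
  have x: "x \<notin> set xs" using Cons.prems(1) by auto
  have nested: "\<forall>y\<in>set xs. p y \<le> p x \<and> r y \<le> r x" using Cons.prems(2) by simp
  have pr: "p x + r x \<le> n" using Cons.prems(3) by simp
  have prod: "(\<Prod>j<length (x # xs). q_binomial q (int n - int (p ((x # xs) ! j))
          - int (r ((x # xs) ! j)) - int (\<Sum>l<j. s ((x # xs) ! l))) (s ((x # xs) ! j))) =
      q_binomial q (int n - int (p x) - int (r x)) (s x) *
      (\<Prod>j<length xs. q_binomial q (int n - int (s x) - int (p (xs ! j)) - int (r (xs ! j))
          - int (\<Sum>l<j. s (xs ! l))) (s (xs ! j)))"
    unfolding length_Cons
    by (subst prod.lessThan_Suc_shift)
      (simp add: sum.lessThan_Suc_shift algebra_simps del: sum.lessThan_Suc)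
  show ?case
  proof (cases "p x + r x + s x \<le> n")
    case False
    \<comment> \<open>The window is too short for \<open>s x\<close> letters. The right-hand side
      vanishes as well, by the default value of \<open>q_binomial\<close>.\<close>
    have "col_words p r s (x # xs) n = {}"
    proof (rule ccontr)
      assume "col_words p r s (x # xs) n \<noteq> {}"
      then obtain w where w: "w \<in> col_words p r s (x # xs) n" by auto
      from w pr obtain v where "count_list v x = s x" "length v = n - p x - r x"
        by (rule col_words_ConsE)
      then show False using False count_le_length[of v x] pr by simp
    qed
    moreover have "q_binomial q (int n - int (p x) - int (r x)) (s x) = 0"
      using False by (simp add: q_binomial_def)
    ultimately show ?thesis unfolding prod by simp
  next
    case True
    let ?n = "n - s x" and ?k = "n - p x - r x - s x"
    have inner: "(\<Sum>w\<in>{w \<in> col_words p r s (x # xs) n. ?f w = w'}. q powi col_stat p r (x # xs) w) =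
        gauss q ?k (s x) * q powi col_stat p r xs w'"
      if w': "w' \<in> col_words p r s xs ?n" for w'
    proof -
      define u v' z where "u = take (p x) w'" and "v' = window (p x) (r x) w'"
        and "z = drop (length w' - r x) w'"
      have l: "length w' = ?n" and sw': "set w' \<subseteq> set xs"
        using w' by (auto simp: col_words_def)
      have e: "w' = u @ v' @ z" and lu: "length u = p x" and lz: "length z = r x"
        using append_window[of "p x" "r x" w'] True l by (auto simp: u_def v'_def z_def)
      have lv': "length v' = ?k" using l by (simp add: v'_def window_def)
      have sv': "set v' \<subseteq> set xs" using sw' e by auto
      have xw': "x \<notin> set w'" using x sw' by auto
      \<comment> \<open>Within a group only \<open>word_maj v\<close> varies: deleting
        \<open>x\<close> always turns the window \<open>v\<close> into \<open>v'\<close> and the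
        whole word into \<open>w'\<close>.\<close>
      have stat: "q powi col_stat p r (x # xs) (u @ v @ z) =
          q powi (col_stat p r xs w' - int (word_maj v')) * q ^ word_maj v"
        if "v \<in> insertions x (s x) v'" for v
      proof -
        have "col_stat p r (x # xs) (u @ v @ z) =
            (col_stat p r xs w' - int (word_maj v')) + int (word_maj v)"
          using that e lu lz xw' by (simp add: window_append insertions_def filter_neq_id)
        then show ?thesis by (simp only: power_int_add q_nonzero power_int_of_nat simp_thms)
      qed
      have "(\<Sum>w\<in>{w \<in> col_words p r s (x # xs) n. ?f w = w'}. q powi col_stat p r (x # xs) w) =
          (\<Sum>v\<in>insertions x (s x) v'. q powi col_stat p r (x # xs) (u @ v @ z))"
        by (subst col_words_fiber[OF True x nested e lu lz w'], subst sum.reindex)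
          (auto simp: inj_on_def)
      also have "\<dots> = (\<Sum>v\<in>insertions x (s x) v'.
          q powi (col_stat p r xs w' - int (word_maj v')) * q ^ word_maj v)"
        by (rule sum.cong[OF refl stat])
      also have "\<dots> = q powi (col_stat p r xs w' - int (word_maj v')) *
          (q ^ word_maj v' * gauss q ?k (s x))"
        using Cons.prems(1) sv' lv' sum_insertions[of v' x "s x"]
        by (fastforce simp flip: sum_distrib_left)
      also have "\<dots> = gauss q ?k (s x) * q powi col_stat p r xs w'"
        using q_nonzero by (simp add: power_int_diff)
      finally show ?thesis .
    qed
    have "(\<Sum>w\<in>col_words p r s (x # xs) n. q powi col_stat p r (x # xs) w) =
        (\<Sum>w'\<in>col_words p r s xs ?n.
           \<Sum>w\<in>{w \<in> col_words p r s (x # xs) n. ?f w = w'}. q powi col_stat p r (x # xs) w)"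
      using filter_col_words[OF pr x nested, of _ s]
      by (intro sum.group[symmetric] finite_col_words) auto
    also have "\<dots> = gauss q ?k (s x) * (\<Sum>w'\<in>col_words p r s xs ?n. q powi col_stat p r xs w')"
      by (simp only: inner sum_distrib_left cong: sum.cong)
    also have "(\<Sum>w'\<in>col_words p r s xs ?n. q powi col_stat p r xs w') =
       (\<Prod>j<length xs. q_binomial q (int ?n - int (p (xs ! j)) - int (r (xs ! j))
          - int (\<Sum>l<j. s (xs ! l))) (s (xs ! j)))"
      using Cons.prems True nested by (intro Cons.IH) fastforce+
    also have "int ?n = int n - int (s x)" using True by simp
    also have "gauss q ?k (s x) = q_binomial q (int n - int (p x) - int (r x)) (s x)"
      using True by (simp add: q_binomial_eq_gauss[symmetric] of_nat_diff algebra_simps)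
    finally show ?thesis unfolding prod .
  qed
qed

section \<open>The major index of a rectangle\<close>

text \<open>A descent at position \<open>j\<close> is counted for
  \<open>i = j + 1, ..., length w - 1\<close>, that is, once for each letter after position
  \<open>j\<close>. This is its weight in \<open>word_maj\<close>.\<close>

lemma word_maj_eq_sum:
  "(\<Sum>i<length w. card {j. j < i \<and> w ! Suc j < w ! j}) = word_maj w"
proof (induction w rule: word_maj.induct)
  case (1 a b w)
  let ?D = "\<lambda>v i. {j. j < i \<and> v ! Suc j < v ! j}"
  have "card (?D (a # b # w) (Suc i)) = (if b < a then 1 else 0) + card (?D (b # w) i)" for i
  proof -
    have "?D (a # b # w) (Suc i) = (if b < a then {0} else {}) \<union> Suc ` ?D (b # w) i"
      by (auto simp: image_iff less_Suc_eq_0_disj)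
    also have "card \<dots> = card (if b < a then {0::nat} else {}) + card (Suc ` ?D (b # w) i)"
      by (rule card_Un_disjoint) auto
    finally show ?thesis by (simp add: card_image)
  qed
  then show ?case
    unfolding length_Cons[of a] sum.lessThan_Suc_shift using 1 by (simp add: sum.distrib)
qed auto

section \<open>Fillings read as words of column coordinates\<close>

definition one_per_row :: "cell set \<Rightarrow> bool" where
  "one_per_row M \<longleftrightarrow> finite M \<and> inj_on snd M"

definition cell_in_row :: "cell set \<Rightarrow> int \<Rightarrow> int" where
  "cell_in_row M y = (THE x. (x, y) \<in> M)"

definition row_word :: "cell set \<Rightarrow> int list \<Rightarrow> int list" where
  "row_word M ys = map (cell_in_row M) ys"

lemma cell_in_row_eq: "one_per_row M \<Longrightarrow> (x, y) \<in> M \<Longrightarrow> cell_in_row M y = x"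
  unfolding cell_in_row_def one_per_row_def
  by (rule the_equality) (auto dest: inj_onD[of snd M "(_, y)" "(x, y)"])

text \<open>In an empty row \<open>cell_in_row\<close> is unspecified, hence the first
  conjunct.\<close>

lemma mem_iff_cell_in_row:
  "one_per_row M \<Longrightarrow> (x, y) \<in> M \<longleftrightarrow> y \<in> snd ` M \<and> cell_in_row M y = x"
  using cell_in_row_eq by force

lemma one_per_row_subset: "one_per_row M \<Longrightarrow> M' \<subseteq> M \<Longrightarrow> one_per_row M'"
  by (auto simp: one_per_row_def inj_on_def intro: finite_subset)

lemma set_nonempty_rows: "finite M \<Longrightarrow> set (nonempty_rows M) = snd ` M"
  by (simp add: nonempty_rows_def)

lemma nonempty_rows_unique:
  assumes "set ys = snd ` M" "sorted_wrt (>) ys"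
  shows "nonempty_rows M = ys"
proof -
  have "sorted_wrt (<) (rev ys)" using assms(2) by (simp add: sorted_wrt_rev)
  then have "sorted_list_of_set (set (rev ys)) = rev ys"
    by (simp only: strict_sorted_iff sorted_list_of_set.idem_if_sorted_distinct)
  then show ?thesis using assms(1) by (simp add: nonempty_rows_def)
qed

lemma sorted_nonempty_rows: "sorted_wrt (>) (nonempty_rows M)"
  by (simp add: nonempty_rows_def sorted_wrt_rev)

lemma nonempty_rows_from_row_up:
  assumes "finite M" "i < length (nonempty_rows M)"
  shows "nonempty_rows (M \<inter> from_row_up (nonempty_rows M ! i)) = take (Suc i) (nonempty_rows M)"
proof (rule nonempty_rows_unique)
  let ?r = "nonempty_rows M"
  show "sorted_wrt (>) (take (Suc i) ?r)"
    using sorted_nonempty_rows by (rule sorted_wrt_take)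
  have "y \<in> set (take (Suc i) ?r) \<longleftrightarrow> y \<in> set ?r \<and> ?r ! i \<le> y" for y
  proof -
    have "?r ! i \<le> ?r ! j \<longleftrightarrow> j \<le> i" if "j < length ?r" for j
      using sorted_wrt_nth_less[OF sorted_nonempty_rows, of i j M]
        sorted_wrt_nth_less[OF sorted_nonempty_rows, of j i M] that assms(2)
      by (cases i j rule: linorder_cases) auto
    moreover have "set (take (Suc i) ?r) = (!) ?r ` {..i}"
      using nth_image[of "Suc i" ?r] assms(2)
      by (simp add: atLeast0LessThan lessThan_Suc_atMost)
    moreover have "set ?r = (!) ?r ` {..<length ?r}"
      by (auto simp: set_conv_nth)
    ultimately show ?thesis
      using assms(2) by auto
  qed
  then show "set (take (Suc i) ?r) = snd ` (M \<inter> from_row_up (?r ! i))"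
    using set_nonempty_rows[OF assms(1)] by (auto simp: from_row_up_def image_iff) force+
qed

text \<open>By contiguity, the rectangle spanned by two cells of \<open>M\<close> lies in the
  product of \<open>X\<close> and \<open>C\<close>. An NE chain in consecutive nonempty rows is
  therefore just a descent of the word.\<close>

lemma maj_rect_eq_word_maj:
  assumes M: "one_per_row M" "M \<subseteq> X \<times> C" and "contiguous X" "contiguous C"
  shows "maj_rect (X \<times> C) M = word_maj (row_word M (nonempty_rows M))"
proof -
  let ?r = "nonempty_rows M"
  let ?w = "row_word M ?r"
  have fin: "finite M" using M by (simp add: one_per_row_def)
  have "des ((X \<times> C) \<inter> from_row_up (?r ! i)) (M \<inter> from_row_up (?r ! i)) =
      card {j. j < i \<and> ?w ! Suc j < ?w ! j}" if i: "i < length ?r" for i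
  proof -
    have chain: "(\<exists>x x'. NE_chain ((X \<times> C) \<inter> from_row_up (?r ! i)) (M \<inter> from_row_up (?r ! i))
            (x', ?r ! Suc j) (x, ?r ! j)) \<longleftrightarrow> ?w ! Suc j < ?w ! j" if j: "j < i" for j
    proof -
      define y y' where "y = ?r ! j" and "y' = ?r ! Suc j"
      have "y \<in> set ?r" "y' \<in> set ?r" using i j by (auto simp: y_def y'_def)
      then obtain x x' where x: "(x, y) \<in> M" "(x', y') \<in> M"
        by (auto simp: set_nonempty_rows fin)
      then have w: "?w ! j = x" "?w ! Suc j = x'"
        using i j M by (auto simp: row_word_def cell_in_row_eq y_def y'_def)
      have yy': "y' < y"
        using sorted_wrt_nth_less[OF sorted_nonempty_rows, of j "Suc j" M] i j
        by (auto simp: y_def y'_def)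
      have iy': "?r ! i \<le> y'"
        using sorted_wrt_nth_less[OF sorted_nonempty_rows, of "Suc j" i M] i j
        by (cases "Suc j = i") (auto simp: y'_def)
      have X: "x \<in> X" "x' \<in> X" "y \<in> C" "y' \<in> C" using x M by auto
      then have "{x'..x} \<times> {y'..y} \<subseteq> X \<times> C"
        using assms(3,4) unfolding contiguous_def by (intro Sigma_mono) auto
      then have "NE_chain ((X \<times> C) \<inter> from_row_up (?r ! i)) (M \<inter> from_row_up (?r ! i)) (x', y') (x, y)
          \<longleftrightarrow> x' < x"
        using x yy' iy' by (auto simp: NE_chain_def from_row_up_def)
      moreover have "x1 = x \<and> x1' = x'"
        if "NE_chain ((X \<times> C) \<inter> from_row_up (?r ! i)) (M \<inter> from_row_up (?r ! i)) (x1', y') (x1, y)"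
        for x1 x1'
      proof -
        have "(x1, y) \<in> M" "(x1', y') \<in> M" using that by (auto simp: NE_chain_def)
        then show ?thesis using x cell_in_row_eq[OF M(1)] by metis
      qed
      ultimately show ?thesis unfolding w y_def[symmetric] y'_def[symmetric] by blast
    qed
    have "j + 1 < length (take (Suc i) ?r) \<longleftrightarrow> j < i" for j using i by auto
    then show ?thesis
      unfolding des_def nonempty_rows_from_row_up[OF fin i] Let_def
      by (intro arg_cong[where f = card] Collect_cong conj_cong)
        (simp_all only: nth_take chain Suc_less_eq less_SucI Suc_eq_plus1[symmetric])
  qed
  then show ?thesis
    by (simp add: maj_rect_def Let_def word_maj_eq_sum[symmetric]) (simp add: row_word_def)
qed

text \<open>The major index of the part of \<open>M\<close> in the product of \<open>X\<close> and
  \<open>C\<close>, cut out of the row list of \<open>M\<close> itself. It makes sense for any set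
  \<open>X\<close> of columns, as arises when columns are removed one at a time.\<close>

definition block_maj :: "cell set \<Rightarrow> int set \<Rightarrow> int set \<Rightarrow> nat" where
  "block_maj M X C = word_maj (row_word M
     (filter (\<lambda>y. y \<in> C \<and> cell_in_row M y \<in> X) (nonempty_rows M)))"

lemma maj_rect_Int:
  assumes M: "one_per_row M" and "contiguous X" "contiguous C"
  shows "maj_rect (X \<times> C) (M \<inter> X \<times> C) = block_maj M X C"
proof -
  let ?M = "M \<inter> X \<times> C"
  have fin: "finite M" using M by (simp add: one_per_row_def)
  have M': "one_per_row ?M" using M by (rule one_per_row_subset) auto
  have r: "nonempty_rows ?M = filter (\<lambda>y. y \<in> C \<and> cell_in_row M y \<in> X) (nonempty_rows M)"
  proof (rule nonempty_rows_unique)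
    show "set (filter (\<lambda>y. y \<in> C \<and> cell_in_row M y \<in> X) (nonempty_rows M)) = snd ` ?M"
      using cell_in_row_eq[OF M] by (force simp: set_nonempty_rows fin)
  qed (intro sorted_wrt_filter sorted_nonempty_rows)
  have "row_word ?M (nonempty_rows ?M) = row_word M (nonempty_rows ?M)"
    unfolding row_word_def
  proof (rule map_cong)
    fix y assume "y \<in> set (nonempty_rows ?M)"
    then obtain x where "(x, y) \<in> ?M" using fin by (auto simp: set_nonempty_rows)
    then show "cell_in_row ?M y = cell_in_row M y"
      using cell_in_row_eq[OF M] cell_in_row_eq[OF M'] by auto
  qed simp
  then show ?thesis
    using assms(2,3) by (subst maj_rect_eq_word_maj[OF M']) (auto simp: block_maj_def r)
qed

lemma block_maj_empty [simp]: "block_maj M {} C = 0"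
  by (simp add: block_maj_def row_word_def)

section \<open>Maximal rectangles\<close>

text \<open>Sort the values of \<open>h\<close> and pull them back along the injection
  \<open>h\<close>. Uniqueness reduces to that of a strictly sorted list of numbers.\<close>

lemma ex1_strictly_sorted_by:
  fixes h :: "'a \<Rightarrow> nat"
  assumes "finite S" "inj_on h S"
  shows "\<exists>!xs. set xs = S \<and> sorted_wrt (\<lambda>x y. h x < h y) xs"
proof (rule ex_ex1I)
  let ?l = "sorted_list_of_set (h ` S)"
  have "sorted_wrt (\<lambda>x y. h (inv_into S h x) < h (inv_into S h y)) ?l"
  proof (rule sorted_wrt_mono_rel)
    show "sorted_wrt (<) ?l" by simp
  qed (use assms in \<open>auto simp: f_inv_into_f\<close>)
  moreover have "inv_into S h ` h ` S = S"
    using assms(2) by (force simp: image_iff inv_into_f_f)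
  ultimately show "\<exists>xs. set xs = S \<and> sorted_wrt (\<lambda>x y. h x < h y) xs"
    using assms(1) by (intro exI[of _ "map (inv_into S h) ?l"]) (simp add: sorted_wrt_map)
next
  fix xs ys
  assume xs: "set xs = S \<and> sorted_wrt (\<lambda>x y. h x < h y) xs"
    and ys: "set ys = S \<and> sorted_wrt (\<lambda>x y. h x < h y) ys"
  then have "map h xs = map h ys"
    by (intro strict_sorted_equal) (simp_all add: sorted_wrt_map)
  then show "xs = ys"
    using xs ys assms(2) by (metis inj_on_map_eq_map Un_absorb)
qed

lemma contiguous_eq_interval:
  assumes "contiguous S" "finite S" "S \<noteq> {}"
  obtains a b where "a \<le> b" "S = {a..b}"
proof
  show "Min S \<le> Max S" using assms by simp
  have "{Min S..Max S} \<subseteq> S"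
    using assms(1) Min_in[OF assms(2,3)] Max_in[OF assms(2,3)] unfolding contiguous_def by blast
  then show "S = {Min S..Max S}" using assms(2) by (auto intro: Min_le Max_ge)
qed

definition cols_above :: "cell set \<Rightarrow> int set \<Rightarrow> int set" where
  "cols_above P C = {x. C \<subseteq> column P x}"

text \<open>For the row set \<open>C\<close> of a column of a moon polyomino, these are the columns
  of the next higher maximal rectangle, or none if \<open>C\<close> is the largest row set.\<close>

definition cols_strictly_above :: "cell set \<Rightarrow> int set \<Rightarrow> int set" where
  "cols_strictly_above P C = {x. C \<subset> column P x}"

definition column_sets :: "cell set \<Rightarrow> int set set" where
  "column_sets P = column P ` fst ` P"

lemma column_nonempty_iff: "column P x \<noteq> {} \<longleftrightarrow> x \<in> fst ` P"
  by (force simp: column_def)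

lemma mem_column_setsI: "column P x \<noteq> {} \<Longrightarrow> column P x \<in> column_sets P"
  unfolding column_nonempty_iff column_sets_def by auto

section \<open>Maximal rectangles of a moon polyomino and their row sets\<close>

context
  fixes P assumes moon: "moon_polyomino P"
begin

lemma moon_finite: "finite P"
  using moon by (simp add: moon_polyomino_def)

lemma finite_column: "finite (column P x)"
proof (rule finite_subset)
  show "column P x \<subseteq> snd ` P" by (force simp: column_def)
qed (simp add: moon_finite)

lemma contiguous_column: "contiguous (column P x)"
  using moon by (simp add: moon_polyomino_def convex_polyomino_def)

lemma columns_comparable: "column P x \<subseteq> column P x' \<or> column P x' \<subseteq> column P x"
  using moon by (simp add: moon_polyomino_def intersection_free_def)

lemma column_between:
  assumes "x \<le> y" "y \<le> z"
  shows "column P x \<inter> column P z \<subseteq> column P y"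
proof
  fix r assume "r \<in> column P x \<inter> column P z"
  then have "x \<in> row P r" "z \<in> row P r" by (auto simp: row_def column_def)
  moreover have "contiguous (row P r)"
    using moon by (simp add: moon_polyomino_def convex_polyomino_def)
  ultimately show "r \<in> column P y"
    using assms unfolding contiguous_def row_def column_def by fastforce
qed

lemma contiguous_cols_above: "contiguous (cols_above P C)"
  unfolding contiguous_def cols_above_def using column_between by fastforce

lemma finite_cols_above: "C \<noteq> {} \<Longrightarrow> finite (cols_above P C)"
proof (rule finite_subset)
  show "C \<noteq> {} \<Longrightarrow> cols_above P C \<subseteq> fst ` P"
    by (force simp: cols_above_def column_def)
qed (simp add: moon_finite)

lemma column_setsE:
  assumes "C \<in> column_sets P"
  obtains x a b where "C = column P x" "x \<in> cols_above P C" "a \<le> b" "C = {a..b}"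
proof -
  from assms obtain x where x: "C = column P x" "C \<noteq> {}"
    using column_nonempty_iff[of P] by (auto simp: column_sets_def)
  obtain a b where "a \<le> b" "column P x = {a..b}"
    using contiguous_column finite_column x by (metis contiguous_eq_interval)
  moreover have "x \<in> cols_above P C" using x by (simp add: cols_above_def)
  ultimately show thesis using that x(1) by metis
qed

lemma cols_above_interval:
  assumes "C \<in> column_sets P"
  obtains a b where "a \<le> b" "cols_above P C = {a..b}"
proof -
  from assms obtain x a b where "x \<in> cols_above P C" "a \<le> b" "C = {a..b}"
    by (rule column_setsE)
  then have "x \<in> cols_above P C" "C \<noteq> {}" by auto
  then show thesis
    using contiguous_eq_interval[OF contiguous_cols_above finite_cols_above, of C] that by auto
qed

text \<open>Among the columns that a rectangle meets, the shortest is contained in the others by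
  comparability, so a maximal rectangle fills its row set and all columns above it. Conversely, a
  rectangle containing the one built from \<open>C\<close> meets a column with row set
  \<open>C\<close> and so has no further rows or columns.\<close>

lemma max_rectangles_eq: "max_rectangles P = (\<lambda>C. cols_above P C \<times> C) ` column_sets P"
proof (intro set_eqI iffI)
  fix R assume R: "R \<in> max_rectangles P"
  then obtain a b c d where ab: "a \<le> b" "c \<le> d" "R = {a..b} \<times> {c..d}" and RP: "R \<subseteq> P"
    unfolding max_rectangles_def is_rectangle_def by auto
  have "\<exists>x\<in>{a..b}. \<forall>y\<in>{a..b}. column P x \<subseteq> column P y"
  proof -
    obtain x where x: "x \<in> {a..b}" "\<forall>y\<in>{a..b}. card (column P x) \<le> card (column P y)"
      using ex_min_if_finite[of "(\<lambda>x. card (column P x)) ` {a..b}"] ab(1) by (force simp: not_less)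
    have "column P x \<subseteq> column P y" if "y \<in> {a..b}" for y
      using columns_comparable[of x y] x(2) that card_seteq[OF finite_column, of "column P y" x]
      by auto
    with x(1) show ?thesis by blast
  qed
  then obtain x where x: "x \<in> {a..b}" "\<forall>y\<in>{a..b}. column P x \<subseteq> column P y" by auto
  let ?C = "column P x"
  have cd: "{c..d} \<subseteq> ?C" using RP x(1) unfolding ab(3) column_def by auto
  then have "?C \<noteq> {}" using ab(2) by auto
  then have C: "?C \<in> column_sets P" by (rule mem_column_setsI)
  have "is_rectangle (cols_above P ?C \<times> ?C)"
    using cols_above_interval[OF C] column_setsE[OF C] unfolding is_rectangle_def by metis
  moreover have "cols_above P ?C \<times> ?C \<subseteq> P" by (auto simp: cols_above_def column_def)
  moreover have "R \<subseteq> cols_above P ?C \<times> ?C"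
    using x(2) cd unfolding ab(3) by (auto simp: cols_above_def)
  ultimately have "cols_above P ?C \<times> ?C = R" using R unfolding max_rectangles_def by blast
  with C show "R \<in> (\<lambda>C. cols_above P C \<times> C) ` column_sets P" by auto
next
  fix R assume "R \<in> (\<lambda>C. cols_above P C \<times> C) ` column_sets P"
  then obtain C where C: "C \<in> column_sets P" and R: "R = cols_above P C \<times> C" by auto
  have rect: "is_rectangle R"
    using cols_above_interval[OF C] column_setsE[OF C] unfolding is_rectangle_def R by metis
  have RP: "R \<subseteq> P" by (auto simp: cols_above_def column_def R)
  have "R' = R" if R': "is_rectangle R'" "R' \<subseteq> P" "R \<subseteq> R'" for R'
  proof -
    obtain x c' d' where x': "C = column P x" "x \<in> cols_above P C" "c' \<le> d'" "C = {c'..d'}"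
      using C by (rule column_setsE)
    then have x: "C = column P x" "x \<in> cols_above P C" "C \<noteq> {}" by auto
    from R'(1) obtain a b c d where R'_eq: "R' = {a..b} \<times> {c..d}"
      unfolding is_rectangle_def by auto
    have CD: "C \<subseteq> {c..d}" using R'(3) x unfolding R R'_eq by auto
    have "x \<in> {a..b}" using R'(3) x unfolding R R'_eq by auto
    then have "{c..d} \<subseteq> C" using R'(2) unfolding x(1) R'_eq by (auto simp: column_def)
    then have "{c..d} = C" using CD by auto
    moreover have "{a..b} \<subseteq> cols_above P {c..d}"
      using R'(2) unfolding R'_eq by (auto simp: cols_above_def column_def)
    ultimately show ?thesis using R'(3) unfolding R R'_eq by auto
  qed
  with rect RP show "R \<in> max_rectangles P" unfolding max_rectangles_def by blast
qed

lemma column_sets_chain: "C \<in> column_sets P \<Longrightarrow> D \<in> column_sets P \<Longrightarrow> C \<subseteq> D \<or> D \<subseteq> C"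
  using columns_comparable by (auto simp: column_sets_def)

lemma finite_mem_column_sets: "C \<in> column_sets P \<Longrightarrow> finite C"
  using finite_column by (auto simp: column_sets_def)

lemma column_sets_psubset:
  assumes "C \<in> column_sets P" "D \<in> column_sets P" "card C < card D"
  shows "C \<subset> D"
  using assms column_sets_chain[of C D] card_mono[of C D] finite_mem_column_sets[of C] by auto

lemma rows_cols_above: "C \<in> column_sets P \<Longrightarrow> rows (cols_above P C \<times> C) = C"
  by (erule column_setsE) (auto simp: rows_def)

text \<open>The row sets of columns form a chain of finite sets, so cardinality tells them apart.
  Heights are thus injective on maximal rectangles, and the list chosen by \<open>THE\<close> exists
  uniquely.\<close>

lemma max_rectangle_list_props:
  "set (max_rectangle_list P) = max_rectangles P"
  "sorted_wrt (\<lambda>R R'. height R < height R') (max_rectangle_list P)"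
proof -
  have "inj_on card (column_sets P)"
  proof (rule inj_onI)
    fix C D assume CD: "C \<in> column_sets P" "D \<in> column_sets P" "card C = card D"
    then show "C = D"
      using column_sets_chain[OF CD(1,2)] finite_mem_column_sets card_subset_eq by metis
  qed
  then have "inj_on height (max_rectangles P)"
    unfolding max_rectangles_eq inj_on_def by (auto simp: height_def rows_cols_above)
  moreover have "finite (max_rectangles P)"
    unfolding max_rectangles_eq column_sets_def using moon_finite by simp
  ultimately have "\<exists>!Rs. set Rs = max_rectangles P \<and>
      sorted_wrt (\<lambda>R R'. height R < height R') Rs"
    by (intro ex1_strictly_sorted_by)
  from theI'[OF this] show "set (max_rectangle_list P) = max_rectangles P"
    "sorted_wrt (\<lambda>R R'. height R < height R') (max_rectangle_list P)"
    unfolding max_rectangle_list_def by auto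
qed

text \<open>The intersection of two consecutive rectangles has the rows of the lower and the columns
  of the higher one, and the latter are exactly the columns strictly above the former row
  set.\<close>

lemma maj_eq_sum_column_sets:
  assumes M: "one_per_row M"
  shows "maj P M = (\<Sum>C\<in>column_sets P.
    int (block_maj M (cols_above P C) C) - int (block_maj M (cols_strictly_above P C) C))"
proof -
  define Rs where "Rs = max_rectangle_list P"
  define Cs where "Cs = map rows Rs"
  define n where "n = length Rs"
  have mem: "Rs ! i = cols_above P (Cs ! i) \<times> Cs ! i \<and> Cs ! i \<in> column_sets P" if "i < n" for i
  proof -
    have "Rs ! i \<in> max_rectangles P"
      using that max_rectangle_list_props(1) nth_mem unfolding Rs_def n_def by blast
    then show ?thesis using that unfolding max_rectangles_eq
      by (auto simp: Cs_def n_def rows_cols_above)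
  qed
  have set_Cs: "set Cs = column_sets P"
    unfolding Cs_def Rs_def set_map max_rectangle_list_props(1) max_rectangles_eq image_image
    by (simp add: rows_cols_above)
  have less: "Cs ! i \<subset> Cs ! j" if "i < j" "j < n" for i j
  proof -
    have "height (Rs ! i) < height (Rs ! j)"
      using that max_rectangle_list_props(2) unfolding Rs_def n_def by (simp add: sorted_wrt_iff_nth_less)
    then have "card (Cs ! i) < card (Cs ! j)"
      using that by (simp add: height_def Cs_def n_def)
    then show ?thesis using mem that by (intro column_sets_psubset) auto
  qed
  have bij: "bij_betw ((!) Cs) {..<n} (column_sets P)"
    unfolding set_Cs[symmetric]
  proof (rule bij_betw_nth)
    show "distinct Cs" unfolding distinct_conv_nth
      using less by (metis Cs_def length_map linorder_neqE_nat n_def psubsetE order_refl)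
  qed (auto simp: Cs_def n_def)
  have above: "cols_strictly_above P (Cs ! i) =
      (if Suc i < n then cols_above P (Cs ! Suc i) else {})" if i: "i < n" for i
  proof -
    have "\<exists>k<n. i < k \<and> column P x = Cs ! k" if x: "x \<in> cols_strictly_above P (Cs ! i)" for x
    proof -
      have x': "Cs ! i \<subset> column P x" using x by (simp add: cols_strictly_above_def)
      then have "column P x \<in> set Cs" unfolding set_Cs by (intro mem_column_setsI) auto
      then obtain k where k: "k < n" "column P x = Cs ! k"
        by (auto simp: in_set_conv_nth Cs_def n_def)
      then have "i < k" using x' less[of k i] i by (metis linorder_neqE_nat psubsetE psubset_imp_subset)
      with k show ?thesis by auto
    qed
    moreover have "Cs ! Suc i \<subseteq> Cs ! k" if "i < k" "k < n" for k
      using less[of "Suc i" k] that by (cases "Suc i = k") auto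
    ultimately have "cols_strictly_above P (Cs ! i) \<subseteq>
        (if Suc i < n then cols_above P (Cs ! Suc i) else {})"
      by (fastforce simp: cols_above_def)
    moreover have "cols_above P (Cs ! Suc i) \<subseteq> cols_strictly_above P (Cs ! i)" if "Suc i < n"
      using less[of i "Suc i"] that by (auto simp: cols_above_def cols_strictly_above_def)
    ultimately show ?thesis by auto
  qed
  have cont: "contiguous (Cs ! i)" if "i < n" for i
    using mem[OF that] contiguous_column by (auto simp: column_sets_def)
  have 1: "maj_rect (Rs ! i) (M \<inter> Rs ! i) = block_maj M (cols_above P (Cs ! i)) (Cs ! i)"
    if "i < n" for i
    using mem[OF that] maj_rect_Int[OF M contiguous_cols_above cont[OF that]] by simp
  have 2: "maj_rect (Rs ! i \<inter> Rs ! (i + 1)) (M \<inter> (Rs ! i \<inter> Rs ! (i + 1))) =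
      block_maj M (cols_strictly_above P (Cs ! i)) (Cs ! i)" if i: "Suc i < n" for i
  proof -
    have "Rs ! i \<inter> Rs ! (i + 1) = cols_above P (Cs ! Suc i) \<times> Cs ! i"
      using mem[of i] mem[of "Suc i"] less[of i "Suc i"] i by (auto simp: cols_above_def)
    then show ?thesis
      using above[of i] i maj_rect_Int[OF M contiguous_cols_above cont[of i]] by simp
  qed
  have "(\<Sum>C\<in>column_sets P. int (block_maj M (cols_strictly_above P C) C)) =
      (\<Sum>i<n. int (block_maj M (cols_strictly_above P (Cs ! i)) (Cs ! i)))"
    by (rule sum.reindex_bij_betw[OF bij, symmetric])
  \<comment> \<open>No column lies strictly above the largest row set, so the last term vanishes and
    the range matches that of the second sum in \<open>maj\<close>.\<close>
  also have "\<dots> = (\<Sum>i<n - 1. int (block_maj M (cols_strictly_above P (Cs ! i)) (Cs ! i)))"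
    using above by (cases n) simp_all
  also have "\<dots> = (\<Sum>i<n - 1. int (maj_rect (Rs ! i \<inter> Rs ! (i + 1)) (M \<inter> (Rs ! i \<inter> Rs ! (i + 1)))))"
    using 2 by (intro sum.cong) auto
  finally have s2: "(\<Sum>C\<in>column_sets P. int (block_maj M (cols_strictly_above P C) C)) = \<dots>" .
  have s1: "(\<Sum>C\<in>column_sets P. int (block_maj M (cols_above P C) C)) =
      (\<Sum>i<n. int (maj_rect (Rs ! i) (M \<inter> Rs ! i)))"
    using sum.reindex_bij_betw[OF bij, of "\<lambda>C. int (block_maj M (cols_above P C) C)"] 1
    by (simp cong: sum.cong_simp)
  show ?thesis
    unfolding sum_subtractf s1 s2 by (simp add: maj_def Let_def Rs_def n_def)
qed

end

section \<open>The major index as a sum over columns\<close>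

text \<open>Applied to the nonempty rows and the row set of a column, \<open>rows_over\<close> and
  \<open>rows_under\<close> give the bounds \<open>p\<close> and \<open>r\<close> of the window of
  that column.\<close>

definition rows_over :: "int list \<Rightarrow> int set \<Rightarrow> nat" where
  "rows_over ys C = length (filter (\<lambda>y. \<forall>z\<in>C. z < y) ys)"

definition rows_under :: "int list \<Rightarrow> int set \<Rightarrow> nat" where
  "rows_under ys C = length (filter (\<lambda>y. \<forall>z\<in>C. y < z) ys)"

lemma decreasing_list_split:
  assumes "sorted_wrt (>) ys" "C = {a..b}" "a \<le> (b::int)"
  obtains us ds where "ys = us @ filter (\<lambda>y. y \<in> C) ys @ ds"
    "length us = rows_over ys C" "length ds = rows_under ys C"
    "set us \<inter> C = {}" "set ds \<inter> C = {}"
proof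
  have "(\<forall>z\<in>C. z < y) \<longleftrightarrow> b < y" "(\<forall>z\<in>C. y < z) \<longleftrightarrow> y < a" for y
    using assms(2,3) by force+
  then show "length (filter (\<lambda>y. b < y) ys) = rows_over ys C"
    "length (filter (\<lambda>y. y < a) ys) = rows_under ys C"
    by (simp_all add: rows_over_def rows_under_def)
  show "ys = filter (\<lambda>y. b < y) ys @ filter (\<lambda>y. y \<in> C) ys @ filter (\<lambda>y. y < a) ys"
    using assms(1)
  proof (induction ys)
    case (Cons y ys)
    have "filter (\<lambda>y. b < y) ys = []" if "y \<le> b"
      using that Cons.prems by (force simp: filter_empty_conv)
    moreover have "filter (\<lambda>y. y \<in> C) ys = []" if "y < a"
      using that Cons.prems assms(2) by (force simp: filter_empty_conv)
    ultimately show ?case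
      using Cons assms(2,3) by (cases "b < y"; cases "y < a") auto
  qed simp
qed (use assms(2,3) in auto)

text \<open>Filtering removes only rows inside \<open>C\<close>, so the numbers of rows above and
  below \<open>C\<close> stay the same. In the application \<open>Q\<close> says that the letter of
  the row has not been deleted yet.\<close>

lemma window_row_word:
  assumes "sorted_wrt (>) ys" "C = {a..b}" "a \<le> b"
    and Q: "\<And>y. y \<in> set ys \<Longrightarrow> y \<notin> C \<Longrightarrow> Q y"
  shows "window (rows_over ys C) (rows_under ys C) (row_word M (filter Q ys)) =
    row_word M (filter (\<lambda>y. y \<in> C \<and> Q y) ys)"
proof -
  obtain us ds where ys: "ys = us @ filter (\<lambda>y. y \<in> C) ys @ ds"
    and l: "length us = rows_over ys C" "length ds = rows_under ys C"
    and d: "set us \<inter> C = {}" "set ds \<inter> C = {}"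
    using assms(1-3) by (rule decreasing_list_split)
  have "set us \<subseteq> set ys" "set ds \<subseteq> set ys" by (subst ys, force)+
  then have "\<forall>y\<in>set us. Q y" "\<forall>y\<in>set ds. Q y" using Q d by blast+
  then have "filter Q us = us" "filter Q ds = ds" by (simp_all add: filter_id_conv)
  then have "filter Q ys = us @ filter Q (filter (\<lambda>y. y \<in> C) ys) @ ds"
    by (subst ys) simp
  then show ?thesis using l by (simp add: row_word_def window_append)
qed

text \<open>This translates between cells lying in a column and letters lying in a window.\<close>

lemma nth_mem_iff_position:
  assumes "sorted_wrt (>) ys" "C = {a..b}" "a \<le> b" "i < length ys"
  shows "ys ! i \<in> C \<longleftrightarrow> rows_over ys C \<le> i \<and> i < length ys - rows_under ys C"
proof -
  obtain us ds where ys: "ys = us @ filter (\<lambda>y. y \<in> C) ys @ ds"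
    and l: "length us = rows_over ys C" "length ds = rows_under ys C"
    and d: "set us \<inter> C = {}" "set ds \<inter> C = {}"
    using assms(1-3) by (rule decreasing_list_split)
  define ms where "ms = filter (\<lambda>y. y \<in> C) ys"
  have ms: "set ms \<subseteq> C" by (auto simp: ms_def)
  have ys: "ys = us @ ms @ ds" using ys by (simp add: ms_def)
  have len: "length ys - length ds = length us + length ms" by (simp add: ys)
  consider "i < length us" | "length us \<le> i" "i < length us + length ms"
    | "length us + length ms \<le> i" by linarith
  then show ?thesis
  proof cases
    case 1
    then have "ys ! i \<in> set us" by (simp add: ys nth_append)
    then show ?thesis using 1 d l by auto
  next
    case 2
    then have "i - length us < length ms" "ys ! i = ms ! (i - length us)"
      by (auto simp: ys nth_append)
    then have "ys ! i \<in> set ms" by simp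
    then show ?thesis using 2 ms l len by auto
  next
    case 3
    then have "i - length us - length ms < length ds" "ys ! i = ds ! (i - length us - length ms)"
      using assms(4) by (auto simp: ys nth_append)
    then have "ys ! i \<in> set ds" by simp
    then show ?thesis using 3 d l len by auto
  qed
qed

lemma rows_over_under_eq:
  assumes "sorted_wrt (>) ys" "C = {a..b}" "a \<le> b"
  shows "rows_over ys C + card (set ys \<inter> C) + rows_under ys C = length ys"
proof -
  obtain us ds where "ys = us @ filter (\<lambda>y. y \<in> C) ys @ ds"
    "length us = rows_over ys C" "length ds = rows_under ys C"
    using assms by (rule decreasing_list_split)
  then have "rows_over ys C + length (filter (\<lambda>y. y \<in> C) ys) + rows_under ys C = length ys"
    by (metis add.assoc length_append)
  moreover have "distinct ys"
    using assms(1) by (metis distinct_rev sorted_wrt_rev strict_sorted_iff)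
  ultimately show ?thesis
    by (simp add: distinct_length_filter Int_commute)
qed

lemma not_in_set_take_iff: "x \<notin> set (take k w) \<longleftrightarrow> (\<forall>i<length w. w ! i = x \<longrightarrow> k \<le> i)"
proof -
  have "x \<in> set (take k w) \<longleftrightarrow> (\<exists>i<length w. w ! i = x \<and> i < k)"
    by (auto simp: in_set_conv_nth)
  then show ?thesis using not_le by blast
qed

lemma not_in_set_drop_iff: "x \<notin> set (drop k w) \<longleftrightarrow> (\<forall>i<length w. w ! i = x \<longrightarrow> i < k)"
proof -
  have "x \<in> set (drop k w) \<longleftrightarrow> (\<exists>i<length w. w ! i = x \<and> k \<le> i)"
  proof
    assume "x \<in> set (drop k w)"
    then obtain j where "j < length w - k" "w ! (k + j) = x" by (auto simp: in_set_conv_nth)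
    then show "\<exists>i<length w. w ! i = x \<and> k \<le> i" by (intro exI[of _ "k + j"]) auto
  next
    assume "\<exists>i<length w. w ! i = x \<and> k \<le> i"
    then obtain i where "i < length w" "w ! i = x" "k \<le> i" by auto
    then have "i - k < length (drop k w)" "drop k w ! (i - k) = x" by auto
    then show "x \<in> set (drop k w)" using nth_mem by blast
  qed
  then show ?thesis using not_le by blast
qed

lemma block_maj_cong:
  assumes "finite M" "\<And>y. y \<in> snd ` M \<Longrightarrow> y \<in> C \<Longrightarrow> cell_in_row M y \<in> X \<longleftrightarrow> cell_in_row M y \<in> Y"
  shows "block_maj M X C = block_maj M Y C"
  unfolding block_maj_def using assms
  by (intro arg_cong[where f = word_maj] arg_cong[where f = "row_word M"] filter_cong)
    (auto simp: set_nonempty_rows)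

section \<open>Deleting the columns one by one\<close>

context
  fixes P assumes moon: "moon_polyomino P"
begin

lemma column_interval:
  assumes "x \<in> fst ` P"
  obtains a b where "column P x = {a..b}" "a \<le> b"
proof -
  have "column P x \<in> column_sets P" using assms by (simp add: column_sets_def)
  then show thesis using that by (rule column_setsE[OF moon])
qed

text \<open>Columns with equal row set \<open>C\<close> are deleted successively, and their
  contributions telescope to the single term for \<open>C\<close>. The last assumption says that a
  row whose letter is already gone lies in every remaining column, hence in every remaining
  window.\<close>

lemma col_stat_eq_sum:
  fixes M
  defines "ys \<equiv> nonempty_rows M"
  assumes M: "one_per_row M" "M \<subseteq> P"
    and "distinct xs" "sorted_wrt (\<lambda>x y. column P x \<subseteq> column P y) xs" "set xs \<subseteq> fst ` P"
    and "\<forall>y\<in>set ys. cell_in_row M y \<notin> set xs \<longrightarrow> (\<forall>x\<in>set xs. y \<in> column P x)"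
  shows "col_stat (\<lambda>x. rows_over ys (column P x)) (\<lambda>x. rows_under ys (column P x)) xs
      (row_word M (filter (\<lambda>y. cell_in_row M y \<in> set xs) ys)) =
    (\<Sum>C\<in>column P ` set xs. int (block_maj M {x \<in> set xs. C \<subseteq> column P x} C)
      - int (block_maj M {x \<in> set xs. C \<subset> column P x} C))"
  using assms(4-)
proof (induction xs)
  case Nil
  then show ?case by simp
next
  case (Cons x xs)
  let ?f = "cell_in_row M" and ?D = "column P x"
  let ?p = "\<lambda>x. rows_over ys (column P x)" and ?r = "\<lambda>x. rows_under ys (column P x)"
  let ?w = "row_word M (filter (\<lambda>y. ?f y \<in> set (x # xs)) ys)"
  let ?B = "\<lambda>xs C. int (block_maj M {x \<in> set xs. C \<subseteq> column P x} C)
      - int (block_maj M {x \<in> set xs. C \<subset> column P x} C)"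
  have x: "x \<notin> set xs" and D: "\<And>y. y \<in> set xs \<Longrightarrow> ?D \<subseteq> column P y"
    using Cons.prems by auto
  have in_P: "y \<in> column P (?f y)" if "y \<in> set ys" for y
  proof -
    have "y \<in> snd ` M" using that M(1) by (simp add: ys_def set_nonempty_rows one_per_row_def)
    then have "(?f y, y) \<in> M" using mem_iff_cell_in_row[OF M(1)] by blast
    then show ?thesis using M(2) by (auto simp: column_def)
  qed
  obtain a b where ab: "?D = {a..b}" "a \<le> b"
    using column_interval[of x] Cons.prems(3) by (metis list.set_intros(1) subsetD)
  have sorted: "sorted_wrt (>) ys" unfolding ys_def by (rule sorted_nonempty_rows)
  have win: "window (?p x) (?r x) ?w = row_word M (filter (\<lambda>y. y \<in> ?D \<and> ?f y \<in> set (x # xs)) ys)"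
    using Cons.prems(4) by (intro window_row_word[OF sorted ab]) auto
  have fil: "filter (\<lambda>a. a \<noteq> x) (row_word M (filter (\<lambda>y. R y \<and> ?f y \<in> set (x # xs)) ys)) =
      row_word M (filter (\<lambda>y. R y \<and> ?f y \<in> set xs) ys)" for R
    using x by (auto simp: row_word_def filter_map o_def intro!: arg_cong[where f = "map ?f"] filter_cong)
  have step: "col_stat ?p ?r (x # xs) ?w =
      int (block_maj M (set (x # xs)) ?D) - int (block_maj M (set xs) ?D) +
      col_stat ?p ?r xs (row_word M (filter (\<lambda>y. ?f y \<in> set xs) ys))"
    using fil[of "\<lambda>y. y \<in> ?D"] fil[of "\<lambda>_. True"]
    unfolding col_stat.simps win by (simp add: block_maj_def ys_def)
  have IH: "col_stat ?p ?r xs (row_word M (filter (\<lambda>y. ?f y \<in> set xs) ys)) =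
      (\<Sum>C\<in>column P ` set xs. ?B xs C)"
  proof (rule Cons.IH)
    show "\<forall>y\<in>set ys. ?f y \<notin> set xs \<longrightarrow> (\<forall>z\<in>set xs. y \<in> column P z)"
    proof (intro ballI impI)
      fix y z assume y: "y \<in> set ys" "?f y \<notin> set xs" and z: "z \<in> set xs"
      show "y \<in> column P z"
      proof (cases "?f y = x")
        case True
        \<comment> \<open>The row of a deleted \<open>x\<close> lies in column \<open>x\<close> and
          therefore in all later, larger columns.\<close>
        then show ?thesis using in_P[OF y(1)] D[OF z] by auto
      next
        case False
        then show ?thesis using Cons.prems(4) y z by simp
      qed
    qed
  qed (use Cons.prems(1-3) in simp_all)
  \<comment> \<open>Such a \<open>C\<close> is strictly larger than the row set of \<open>x\<close>,
    so \<open>x\<close> belongs to neither of its two blocks.\<close>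
  have other: "?B (x # xs) C = ?B xs C" if "C \<in> column P ` set xs - {?D}" for C
  proof -
    have "\<not> C \<subseteq> ?D" using that D by auto
    then have "{y \<in> set (x # xs). C \<subseteq> column P y} = {y \<in> set xs. C \<subseteq> column P y}"
      "{y \<in> set (x # xs). C \<subset> column P y} = {y \<in> set xs. C \<subset> column P y}"
      by auto
    then show ?thesis by simp
  qed
  have strict: "{y \<in> set (x # xs). ?D \<subset> column P y} = {y \<in> set xs. ?D \<subset> column P y}" by auto
  have all: "{y \<in> set (x # xs). ?D \<subseteq> column P y} = set (x # xs)" 
    "{y \<in> set xs. ?D \<subseteq> column P y} = set xs" using D by auto
  have new: "?B (x # xs) ?D = int (block_maj M (set (x # xs)) ?D)
      - int (block_maj M {y \<in> set xs. ?D \<subset> column P y} ?D)"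
    unfolding strict all ..
  have "(\<Sum>C\<in>column P ` set (x # xs). ?B (x # xs) C) =
      ?B (x # xs) ?D + (\<Sum>C\<in>column P ` set xs - {?D}. ?B (x # xs) C)"
    by (simp add: sum.insert_remove)
  also have "\<dots> = ?B (x # xs) ?D + (\<Sum>C\<in>column P ` set xs - {?D}. ?B xs C)"
    using other by simp
  also have "\<dots> = int (block_maj M (set (x # xs)) ?D) - int (block_maj M (set xs) ?D) +
      (\<Sum>C\<in>column P ` set xs. ?B xs C)"
  \<comment> \<open>If a later column has the same row set, its term is already present and only the
    first block gains \<open>x\<close>. Otherwise the term is new, and all later columns are
    strictly above.\<close>
  proof (cases "?D \<in> column P ` set xs")
    case True
    have "(\<Sum>C\<in>column P ` set xs. ?B xs C) = ?B xs ?D + (\<Sum>C\<in>column P ` set xs - {?D}. ?B xs C)"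
      by (rule sum.remove[OF _ True]) simp
    moreover have "?B xs ?D = int (block_maj M (set xs) ?D)
        - int (block_maj M {y \<in> set xs. ?D \<subset> column P y} ?D)"
      unfolding all ..
    ultimately show ?thesis unfolding new by linarith
  next
    case False
    then have "{y \<in> set xs. ?D \<subset> column P y} = set xs" using D by auto
    then show ?thesis unfolding new Diff_insert0[OF False] by simp
  qed
  finally show ?case unfolding step IH ..
qed

lemma maj_eq_col_stat:
  fixes M
  defines "ys \<equiv> nonempty_rows M"
  assumes M: "one_per_row M" "M \<subseteq> P"
    and xs: "distinct xs" "sorted_wrt (\<lambda>x y. column P x \<subseteq> column P y) xs" "set xs = fst ` P"
  shows "maj P M = col_stat (\<lambda>x. rows_over ys (column P x)) (\<lambda>x. rows_under ys (column P x)) xs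
      (row_word M ys)"
proof -
  have fin: "finite M" using M by (simp add: one_per_row_def)
  have in_xs: "cell_in_row M y \<in> set xs" if "y \<in> snd ` M" for y
  proof -
    have "(cell_in_row M y, y) \<in> M" using that mem_iff_cell_in_row[OF M(1)] by blast
    then show ?thesis unfolding xs(3) using M(2) by (force intro: rev_image_eqI)
  qed
  then have fil: "filter (\<lambda>y. cell_in_row M y \<in> set xs) ys = ys"
    by (auto simp: ys_def set_nonempty_rows fin filter_id_conv)
  have blocks: "block_maj M (cols_above P C) C = block_maj M {x \<in> set xs. C \<subseteq> column P x} C"
    "block_maj M (cols_strictly_above P C) C = block_maj M {x \<in> set xs. C \<subset> column P x} C" for C
    using in_xs by (auto simp: cols_above_def cols_strictly_above_def intro!: block_maj_cong[OF fin])
  have "maj P M = (\<Sum>C\<in>column P ` set xs. int (block_maj M {x \<in> set xs. C \<subseteq> column P x} C)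
      - int (block_maj M {x \<in> set xs. C \<subset> column P x} C))"
    unfolding maj_eq_sum_column_sets[OF moon M(1)] column_sets_def blocks xs(3) ..
  also have "\<dots> = col_stat (\<lambda>x. rows_over ys (column P x)) (\<lambda>x. rows_under ys (column P x)) xs
      (row_word M (filter (\<lambda>y. cell_in_row M y \<in> set xs) ys))"
    unfolding ys_def
    by (rule col_stat_eq_sum[OF M xs(1,2), symmetric])
      (use xs(3) in_xs in \<open>auto simp: set_nonempty_rows fin\<close>)
  finally show ?thesis unfolding fil .
qed

end

section \<open>The order on the columns\<close>

lemma strict_mono_col_coord:
  assumes "i \<in> {1..ncols P}" "j \<in> {1..ncols P}" "i < j"
  shows "col_coord P i < col_coord P j"
  unfolding col_coord_def using assms
  by (intro sorted_wrt_nth_less[of "(<)"]) (auto simp: ncols_def)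

lemma col_coord_less_iff:
  assumes "i \<in> {1..ncols P}" "j \<in> {1..ncols P}"
  shows "col_coord P i < col_coord P j \<longleftrightarrow> i < j"
  using strict_mono_col_coord[OF assms] strict_mono_col_coord[OF assms(2,1)]
  by (cases i j rule: linorder_cases) auto

lemma bij_betw_col_coord:
  assumes "finite (fst ` P)"
  shows "bij_betw (col_coord P) {1..ncols P} (fst ` P)"
proof -
  have "bij_betw ((!) (sorted_list_of_set (fst ` P))) {..<ncols P} (fst ` P)"
    using assms by (intro bij_betw_nth) (simp_all add: ncols_def)
  moreover have "bij_betw (\<lambda>i. i - 1) {1..ncols P} {..<ncols P}"
    by (rule bij_betwI[where g = Suc]) auto
  ultimately have "bij_betw ((!) (sorted_list_of_set (fst ` P)) \<circ> (\<lambda>i. i - 1)) {1..ncols P} (fst ` P)"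
    by (rule bij_betw_trans[rotated])
  then show ?thesis by (simp add: col_coord_def[abs_def] o_def)
qed

section \<open>Unimodality of the column lengths and the peak\<close>

context
  fixes P assumes moon: "moon_polyomino P"
begin

lemma col_subset_if_len_le:
  assumes "col_len P i \<le> col_len P j"
  shows "col P i \<subseteq> col P j"
  using columns_comparable[OF moon, of "col_coord P i" "col_coord P j"] assms
    card_seteq[OF finite_column[OF moon], of "col P j" "col_coord P i"]
  unfolding col_len_def col_def by auto

text \<open>Convexity of the rows puts the intersection of the outer columns into the middle one,
  and by comparability that intersection is one of the outer columns.\<close>

lemma col_len_between:
  assumes "1 \<le> i" "i \<le> j" "j \<le> k" "k \<le> ncols P"
  shows "min (col_len P i) (col_len P k) \<le> col_len P j"
proof -
  have "col_coord P i \<le> col_coord P j" "col_coord P j \<le> col_coord P k"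
    using strict_mono_col_coord[of i P j] strict_mono_col_coord[of j P k] assms
    by (cases "i = j"; cases "j = k"; force)+
  then have "col P i \<inter> col P k \<subseteq> col P j"
    unfolding col_def by (rule column_between[OF moon])
  moreover have "col P i \<subseteq> col P k \<or> col P k \<subseteq> col P i"
    unfolding col_def by (rule columns_comparable[OF moon])
  ultimately have "col P i \<subseteq> col P j \<or> col P k \<subseteq> col P j" by auto
  then show ?thesis
    unfolding col_len_def using card_mono finite_column[OF moon] col_def
    by (metis min.coboundedI1 min.coboundedI2)
qed

text \<open>The peak is the leftmost column of maximal length: \<open>col_len_between\<close> gives
  the weak monotonicity on both sides, leastness the strict increase. Of two peaks, the right one
  would be strictly longer than its left neighbour and also no longer than it.\<close>

lemma is_peak_peak:
  assumes "1 \<le> ncols P"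
  shows "is_peak P (peak P)"
proof -
  define top where "top = Max (col_len P ` {1..ncols P})"
  have top: "col_len P i \<le> top" if "i \<in> {1..ncols P}" for i
    using that by (simp add: top_def)
  have "top \<in> col_len P ` {1..ncols P}" unfolding top_def using assms by (intro Max_in) auto
  then have ex: "\<exists>k. k \<in> {1..ncols P} \<and> col_len P k = top" by auto
  define k where "k = (LEAST k. k \<in> {1..ncols P} \<and> col_len P k = top)"
  have k: "k \<in> {1..ncols P}" "col_len P k = top"
    using LeastI_ex[OF ex] unfolding k_def by auto
  have least: "col_len P i < top" if "i \<in> {1..ncols P}" "i < k" for i
    using that not_less_Least[of i "\<lambda>k. k \<in> {1..ncols P} \<and> col_len P k = top"] top[of i]
    unfolding k_def by (metis le_neq_implies_less)
  have peak: "is_peak P k"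
    unfolding is_peak_def
  proof (intro conjI allI impI)
    fix i assume i: "1 \<le> i \<and> i + 1 < k"
    then show "col_len P i \<le> col_len P (i + 1)"
      using col_len_between[of i "i + 1" k] top[of i] k by auto
  next
    fix i assume i: "k \<le> i \<and> i < ncols P"
    then show "col_len P (i + 1) \<le> col_len P i"
      using col_len_between[of k i "i + 1"] top[of "i + 1"] k by auto
  next
    assume "1 < k"
    then have "k - 1 \<in> {1..ncols P}" "k - 1 < k" using k(1) by auto
    then show "col_len P (k - 1) < col_len P k" using least k(2) by simp
  qed (use k in auto)
  have uniq: False if "is_peak P j" "is_peak P j'" "j < j'" for j j'
  proof -
    have "j \<le> j' - 1 \<and> j' - 1 < ncols P" "1 < j'" using that unfolding is_peak_def by auto
    then have "col_len P (j' - 1 + 1) \<le> col_len P (j' - 1)" "col_len P (j' - 1) < col_len P j'"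
      using that(1,2) unfolding is_peak_def by blast+
    then show False using \<open>1 < j'\<close> by simp
  qed
  show ?thesis
    unfolding peak_def
  proof (rule theI)
    show "is_peak P k" by (rule peak)
    show "j = k" if "is_peak P j" for j
      using uniq[OF that peak] uniq[OF peak that] by (meson linorder_neqE_nat)
  qed
qed

end

lemma col_len_mono_before_peak:
  assumes "is_peak P k" "1 \<le> i" "i \<le> j" "j < k"
  shows "col_len P i \<le> col_len P j"
  using assms(3,2,4)
proof (induction rule: dec_induct)
  case (step n)
  then have "col_len P n \<le> col_len P (n + 1)" using assms(1) unfolding is_peak_def by auto
  with step show ?case by simp
qed simp

lemma col_len_antimono_after_peak:
  assumes "is_peak P k" "k \<le> i" "i \<le> j" "j \<le> ncols P"
  shows "col_len P j \<le> col_len P i"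
  using assms(3,2,4)
proof (induction rule: dec_induct)
  case (step n)
  then have "col_len P (n + 1) \<le> col_len P n" using assms(1) unfolding is_peak_def by auto
  with step show ?case by simp
qed simp

text \<open>Lengths weakly increase towards the peak from both sides, so a longer column never lies
  further out on the same side; ties are broken from the outside in.\<close>

lemma col_prec_imp:
  assumes moon: "moon_polyomino P" and ij: "i \<in> {1..ncols P}" "j \<in> {1..ncols P}"
    and prec: "col_prec P i j"
  shows "col P i \<subseteq> col P j" and "if i < peak P then i < j else j < i"
proof -
  have peak: "is_peak P (peak P)" using is_peak_peak[OF moon] ij by simp
  show "col P i \<subseteq> col P j"
    using prec by (intro col_subset_if_len_le[OF moon]) (auto simp: col_prec_def)
  show "if i < peak P then i < j else j < i"
  proof (cases "col_len P i < col_len P j")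
    case True
    then show ?thesis
      using col_len_mono_before_peak[OF peak, of j i] col_len_antimono_after_peak[OF peak, of i j] ij
      by (auto simp: not_less) (metis linorder_not_le)+
  next
    case False
    then show ?thesis using prec by (auto simp: col_prec_def left_cols_def right_cols_def)
  qed
qed

section \<open>Fillings and words\<close>

lemma length_filter_mono:
  "(\<And>x. Q x \<Longrightarrow> R x) \<Longrightarrow> length (filter Q xs) \<le> length (filter R xs)"
  by (induction xs) (auto intro: le_SucI)

lemma extremal_heads_if_sorted_wrt:
  assumes "\<And>x. (\<forall>y. R x y \<longrightarrow> x < y) \<or> (\<forall>y. R x y \<longrightarrow> y < x)" "sorted_wrt R xs"
  shows "extremal_heads xs"
  using assms(2)
proof (induction xs)
  case (Cons x xs)
  then show ?case using assms(1)[of x] by auto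
qed simp

text \<open>The window condition for \<open>x\<close> says that every occurrence of \<open>x\<close>
  stands in a row of column \<open>x\<close>, that is, that its cell lies in
  \<open>P\<close>.\<close>

lemma mem_col_words_iff:
  assumes moon: "moon_polyomino P" and ys: "sorted_wrt (>) ys" and xs: "set xs \<subseteq> fst ` P"
  shows "w \<in> col_words (\<lambda>x. rows_over ys (column P x)) (\<lambda>x. rows_under ys (column P x)) s xs (length ys)
    \<longleftrightarrow> length w = length ys \<and> set w \<subseteq> set xs \<and> (\<forall>x\<in>set xs. count_list w x = s x) \<and>
      (\<forall>i<length ys. (w ! i, ys ! i) \<in> P)"
proof (cases "length w = length ys \<and> set w \<subseteq> set xs")
  case True
  have "x \<notin> set (take (rows_over ys (column P x)) w) \<and>
      x \<notin> set (drop (length w - rows_under ys (column P x)) w) \<longleftrightarrow>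
      (\<forall>i<length ys. w ! i = x \<longrightarrow> (x, ys ! i) \<in> P)" if x: "x \<in> set xs" for x
  proof -
    obtain a b where ab: "column P x = {a..b}" "a \<le> b"
      using column_interval[OF moon] x xs by blast
    show ?thesis
      using nth_mem_iff_position[OF ys ab] True
      unfolding not_in_set_take_iff not_in_set_drop_iff by (auto simp: column_def)
  qed
  moreover have "(\<forall>i<length ys. (w ! i, ys ! i) \<in> P) \<longleftrightarrow>
      (\<forall>x\<in>set xs. \<forall>i<length ys. w ! i = x \<longrightarrow> (x, ys ! i) \<in> P)"
  proof (intro iffI allI impI)
    fix i assume H: "\<forall>x\<in>set xs. \<forall>i<length ys. w ! i = x \<longrightarrow> (x, ys ! i) \<in> P" and i: "i < length ys"
    then have "w ! i \<in> set w" using True by simp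
    then show "(w ! i, ys ! i) \<in> P" using H i True by blast
  qed auto
  ultimately show ?thesis using True by (auto simp: col_words_def)
qed (auto simp: col_words_def)

section \<open>The bijection between fillings and words\<close>

lemma one_per_row_filling:
  assumes "finite P" "is_filling P M"
  shows "one_per_row M"
  unfolding one_per_row_def
proof
  show "finite M" using assms by (auto simp: is_filling_def intro: finite_subset)
  show "inj_on snd M"
  proof (rule inj_onI)
    fix c c' assume c: "c \<in> M" "c' \<in> M" "snd c = snd c'"
    have "row M (snd c) \<subseteq> fst ` M" by (force simp: row_def)
    then have "finite (row M (snd c))" using \<open>finite M\<close> by (auto intro: finite_subset)
    moreover have "card (row M (snd c)) \<le> 1"
      using c(1) assms(2) by (auto simp: is_filling_def rows_def)
    moreover have "fst c \<in> row M (snd c)" "fst c' \<in> row M (snd c)"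
      using c by (auto simp: row_def) (metis prod.collapse)
    ultimately have "fst c = fst c'" by (simp add: card_le_Suc0_iff_eq)
    then show "c = c'" using c(3) by (simp add: prod_eq_iff)
  qed
qed

lemma card_column_eq_count_list:
  assumes "one_per_row M" "set ys = snd ` M" "distinct ys"
  shows "card (column M x) = count_list (row_word M ys) x"
proof -
  have "column M x = {y. x = cell_in_row M y} \<inter> set ys"
    using mem_iff_cell_in_row[OF assms(1)] assms(2) by (auto simp: column_def)
  then show ?thesis
    using distinct_length_filter[OF assms(3), of "\<lambda>y. x = cell_in_row M y"]
    by (simp add: count_list_eq_length_filter row_word_def filter_map o_def)
qed

lemma row_word_zip:
  assumes "length w = length ys" "distinct ys"
  shows "one_per_row (set (zip w ys))" "row_word (set (zip w ys)) ys = w"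
proof -
  show one: "one_per_row (set (zip w ys))"
    unfolding one_per_row_def inj_on_def using assms
    by (auto simp: in_set_zip) (metis nth_eq_iff_index_eq)
  show "row_word (set (zip w ys)) ys = w"
  proof (rule nth_equalityI)
    fix i assume "i < length (row_word (set (zip w ys)) ys)"
    then have i: "i < length ys" by (simp add: row_word_def)
    then have "(w ! i, ys ! i) \<in> set (zip w ys)" using assms(1) by (auto simp: in_set_zip)
    then show "row_word (set (zip w ys)) ys ! i = w ! i"
      using i cell_in_row_eq[OF one] by (simp add: row_word_def)
  qed (simp add: row_word_def assms)
qed

lemma zip_row_word:
  assumes "one_per_row M" "set ys = snd ` M"
  shows "set (zip (row_word M ys) ys) = M"
proof -
  have "set (zip (row_word M ys) ys) = (\<lambda>y. (cell_in_row M y, y)) ` set ys"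
    by (induction ys) (auto simp: row_word_def)
  also have "\<dots> = M" using mem_iff_cell_in_row[OF assms(1)] assms(2) by auto
  finally show ?thesis .
qed

lemma row_nonempty_iff: "row M y \<noteq> {} \<longleftrightarrow> y \<in> snd ` M"
  by (force simp: row_def)

lemma snd_filling:
  assumes "M \<in> fillings P s A"
  shows "snd ` M = rows P - A"
proof -
  have "A = rows P - snd ` M" "M \<subseteq> P"
    using assms row_nonempty_iff[of M] by (auto simp: fillings_def is_filling_def empty_rows_def)
  moreover have "snd ` M \<subseteq> rows P" using \<open>M \<subseteq> P\<close> by (auto simp: rows_def)
  ultimately show ?thesis by auto
qed

text \<open>All these fillings have the same nonempty rows \<open>ys\<close>, so reading off the
  word and zipping it with \<open>ys\<close> are mutually inverse. As letters are coordinates,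
  \<open>t\<close> reindexes \<open>s\<close> from column numbers to coordinates.\<close>

lemma sum_fillings_eq_sum_col_words:
  fixes ys :: "int list"
  assumes moon: "moon_polyomino P" and A: "A \<subseteq> rows P"
    and ys: "set ys = rows P - A" "sorted_wrt (>) ys"
    and xs: "set xs = fst ` P" and s: "\<And>i. i \<in> {1..ncols P} \<Longrightarrow> t (col_coord P i) = s i"
    and gh: "\<And>M. M \<subseteq> P \<Longrightarrow> one_per_row M \<Longrightarrow> snd ` M = set ys \<Longrightarrow> g M = h (row_word M ys)"
  shows "sum g (fillings P s A) = sum h (col_words (\<lambda>x. rows_over ys (column P x))
    (\<lambda>x. rows_under ys (column P x)) t xs (length ys))" (is "_ = sum h ?W")
proof -
  have finP: "finite P" by (rule moon_finite[OF moon])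
  have dist: "distinct ys" using ys(2) by (metis distinct_rev sorted_wrt_rev strict_sorted_iff)
  have coords: "fst ` P = col_coord P ` {1..ncols P}"
    using bij_betw_imp_surj_on[OF bij_betw_col_coord[of P]] finP by simp
  have W: "w \<in> ?W \<longleftrightarrow> length w = length ys \<and> set w \<subseteq> set xs \<and> (\<forall>x\<in>set xs. count_list w x = t x) \<and>
      (\<forall>i<length ys. (w ! i, ys ! i) \<in> P)" for w
    using xs by (intro mem_col_words_iff[OF moon ys(2)]) simp
  have one: "one_per_row M" "M \<subseteq> P" "snd ` M = set ys" if "M \<in> fillings P s A" for M
    using that one_per_row_filling[OF finP] snd_filling[OF that] ys(1)
    by (auto simp: fillings_def is_filling_def)
  show ?thesis
  proof (rule sum.reindex_bij_witness[where i = "\<lambda>w. set (zip w ys)" and j = "\<lambda>M. row_word M ys"])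
    fix M assume M: "M \<in> fillings P s A"
    show "set (zip (row_word M ys) ys) = M"
      using one[OF M] by (intro zip_row_word) auto
    show "h (row_word M ys) = g M" using gh one[OF M] by simp
    have mem: "(cell_in_row M y, y) \<in> P" if "y \<in> set ys" for y
      using mem_iff_cell_in_row[OF one(1)[OF M]] one(2,3)[OF M] that by blast
    show "row_word M ys \<in> ?W"
      unfolding W
    proof (intro conjI ballI allI impI)
      show "set (row_word M ys) \<subseteq> set xs"
        using mem unfolding xs by (force simp: row_word_def intro: rev_image_eqI)
      show "count_list (row_word M ys) x = t x" if x: "x \<in> set xs" for x
      proof -
        obtain i where "i \<in> {1..ncols P}" "x = col_coord P i"
          using x unfolding xs coords by auto
        then show ?thesis
          using M s card_column_eq_count_list[OF one(1)[OF M] one(3)[OF M, symmetric] dist]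
          by (auto simp: fillings_def)
      qed
    qed (use mem in \<open>auto simp: row_word_def\<close>)
  next
    fix w assume w: "w \<in> ?W"
    let ?M = "set (zip w ys)"
    have len: "length w = length ys" using w W by blast
    note M = row_word_zip[OF len dist]
    show "row_word ?M ys = w" by (rule M)
    have snd: "snd ` ?M = set ys" using len by (metis map_snd_zip set_map)
    have "?M \<subseteq> P" using w len unfolding W by (auto simp: in_set_zip)
    moreover have "card (row ?M y) \<le> 1" for y
    proof -
      have "row ?M y \<subseteq> {cell_in_row ?M y}" using cell_in_row_eq[OF M(1)] by (auto simp: row_def)
      then show ?thesis using card_mono[of "{cell_in_row ?M y}"] by simp
    qed
    moreover have "empty_rows P ?M = A"
    proof -
      have "row ?M y = {} \<longleftrightarrow> y \<notin> set ys" for y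
        using row_nonempty_iff[of ?M y] unfolding snd by blast
      then show ?thesis using ys(1) A by (auto simp: empty_rows_def)
    qed
    moreover have "card (column ?M (col_coord P i)) = s i" if "i \<in> {1..ncols P}" for i
    proof -
      have "col_coord P i \<in> set xs" using that unfolding xs coords by auto
      then show ?thesis
        using w s[OF that] card_column_eq_count_list[OF M(1) snd[symmetric] dist] M(2)
        unfolding W by simp
    qed
    ultimately show "?M \<in> fillings P s A" by (simp add: fillings_def is_filling_def)
  qed
qed

section \<open>The generating function as a Laurent series\<close>

lemma q_analog_fls_X: "q_analog (fls_X :: rat fls)"
proof
  show "q_int fls_X (Suc n) \<noteq> (0 :: rat fls)" for n
  proof
    assume "q_int fls_X (Suc n) = (0 :: rat fls)"
    \<comment> \<open>The contradiction is that the constant coefficient of this sum is 1.\<close>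
    then have "fls_nth (\<Sum>i<Suc n. (fls_X :: rat fls) ^ i) 0 = 0" by (simp add: q_int_def)
    then show False by (simp add: sum.lessThan_Suc_shift fls_nth_sum del: sum.lessThan_Suc)
  qed
qed simp

theorem theorem4p1:
  fixes P :: "(int \<times> int) set" and m :: nat and s :: "nat \<Rightarrow> nat" and A :: "int set"
    and a :: "nat \<Rightarrow> nat" and \<iota> :: "nat \<Rightarrow> nat" and h :: "nat \<Rightarrow> int"
  assumes "moon_polyomino P"
    and "m = ncols P"
    and "A \<subseteq> rows P"
    and "card (rows P - A) \<le> (\<Sum>i=1..m. s i)"
    and "\<And>i. i \<in> {1..m} \<Longrightarrow> a i = card (A \<inter> col P i)"
    and "bij_betw \<iota> {1..m} {1..m}"
    and "\<And>j l. 1 \<le> j \<Longrightarrow> j < l \<Longrightarrow> l \<le> m \<Longrightarrow> col_prec P (\<iota> j) (\<iota> l)"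
    and "\<And>j. j \<in> {1..m} \<Longrightarrow>
           h (\<iota> j) = int (col_len P (\<iota> j)) - int (a (\<iota> j)) - int (\<Sum>l=1..<j. s (\<iota> l))"
  shows "(\<Sum>M\<in>fillings P s A. q_indet powi maj P M) = (\<Prod>i=1..m. q_binomial q_indet (h i) (s i))"
proof -
  note moon = assms(1) and m = assms(2) and A = assms(3) and card_le = assms(4) and a = assms(5)
    and bij = assms(6) and prec = assms(7) and h = assms(8)
  interpret q_analog q_indet by (rule q_analog_fls_X)
  have finP: "finite P" by (rule moon_finite[OF moon])
  define ys where "ys = rev (sorted_list_of_set (rows P - A))"
  have fin_rows: "finite (rows P)" using finP by (simp add: rows_def)
  have ys: "set ys = rows P - A" "sorted_wrt (>) ys" "length ys = card (rows P - A)"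
    using fin_rows by (simp_all add: ys_def sorted_wrt_rev)
  \<comment> \<open>The columns in the order \<open>col_prec\<close>, with \<open>Suc\<close>
    because the enumeration \<iota> starts at 1 and lists start at 0.\<close>
  define xs where "xs = map (\<lambda>j. col_coord P (\<iota> (Suc j))) [0..<m]"
  have len: "length xs = m" and nth: "xs ! j = col_coord P (\<iota> (Suc j))" if "j < m" for j
    using that by (simp_all add: xs_def)
  have \<iota>: "\<iota> j \<in> {1..m}" if "j \<in> {1..m}" for j using bij that by (auto dest: bij_betwE)
  have bij_coord: "bij_betw (col_coord P) {1..m} (fst ` P)"
    using bij_betw_col_coord[of P] finP m by simp
  have bij_Suc: "bij_betw Suc {..<m} {1..m}"
    by (rule bij_betwI[where g = "\<lambda>i. i - 1"]) auto
  have bij_xs: "bij_betw (\<lambda>j. col_coord P (\<iota> (Suc j))) {..<m} (fst ` P)"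
    using bij_betw_trans[OF bij_betw_trans[OF bij_Suc bij] bij_coord] by (simp add: o_def)
  have set_xs: "set xs = fst ` P"
    using bij_betw_imp_surj_on[OF bij_xs] by (simp add: xs_def lessThan_atLeast0)
  have dist: "distinct xs"
    using bij_betw_imp_inj_on[OF bij_xs] by (simp add: xs_def distinct_map lessThan_atLeast0)
  define t where "t x = s (the_inv_into {1..m} (col_coord P) x)" for x
  have t: "t (col_coord P i) = s i" if "i \<in> {1..m}" for i
    using that bij_coord unfolding t_def by (simp add: the_inv_into_f_f bij_betw_def)
  let ?p = "\<lambda>x. rows_over ys (column P x)" and ?r = "\<lambda>x. rows_under ys (column P x)"
  \<comment> \<open>The order \<open>col_prec\<close> transported to coordinates, where it can be
    compared with the order of the letters.\<close>
  define R where "R x y \<longleftrightarrow> (\<exists>i\<in>{1..m}. \<exists>j\<in>{1..m}. x = col_coord P i \<and> y = col_coord P j \<and>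
      col_prec P i j)" for x y
  have sorted_R: "sorted_wrt R xs"
    unfolding sorted_wrt_iff_nth_less
  proof (intro allI impI)
    fix i j assume ij: "i < j" "j < length xs"
    then have "j < m" "i < m" by (simp_all add: xs_def)
    then show "R (xs ! i) (xs ! j)"
      unfolding R_def using ij(1) prec[of "Suc i" "Suc j"] \<iota>[of "Suc i"] \<iota>[of "Suc j"]
      by (intro bexI[of _ "\<iota> (Suc i)"] bexI[of _ "\<iota> (Suc j)"]) (auto simp: nth)
  qed
  have extremal: "extremal_heads xs"
  proof (rule extremal_heads_if_sorted_wrt[OF _ sorted_R])
    fix x
    show "(\<forall>y. R x y \<longrightarrow> x < y) \<or> (\<forall>y. R x y \<longrightarrow> y < x)"
    proof (cases "\<exists>i\<in>{1..m}. x = col_coord P i")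
      case True
      then obtain i where i: "i \<in> {1..m}" "x = col_coord P i" by auto
      have "if i < peak P then x < y else y < x" if xy: "R x y" for y
      proof -
        obtain i' j where ij: "i' \<in> {1..m}" "j \<in> {1..m}" "x = col_coord P i'" "y = col_coord P j"
          "col_prec P i' j"
          using xy unfolding R_def by blast
        then have "i' = i" using i inj_onD[OF bij_betw_imp_inj_on[OF bij_coord], of i' i] by simp
        then have "if i < peak P then i < j else j < i"
          using col_prec_imp(2)[OF moon, of i j] m ij(2,5) i(1) by simp
        then show ?thesis
          using col_coord_less_iff[of i P j] col_coord_less_iff[of j P i] i ij(2,4) m by simp
      qed
      then show ?thesis by (cases "i < peak P") auto
    qed (auto simp: R_def)
  qed
  have R_column: "column P x \<subseteq> column P y" if "R x y" for x y
    using that col_prec_imp(1)[OF moon] m unfolding R_def col_def by blast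
  have sorted_column: "sorted_wrt (\<lambda>x y. column P x \<subseteq> column P y) xs"
    by (rule sorted_wrt_mono_rel[OF _ sorted_R]) (rule R_column)
  have sorted_pr: "sorted_wrt (\<lambda>x y. ?p y \<le> ?p x \<and> ?r y \<le> ?r x) xs"
  proof (rule sorted_wrt_mono_rel[OF _ sorted_column])
    fix x y assume "column P x \<subseteq> column P y"
    then show "?p y \<le> ?p x \<and> ?r y \<le> ?r x"
      unfolding rows_over_def rows_under_def
      by (auto intro!: length_filter_mono)
  qed
  have window_size: "?p x + card ((rows P - A) \<inter> column P x) + ?r x = card (rows P - A)"
    if x: "x \<in> set xs" for x
  proof -
    obtain c d where "column P x = {c..d}" "c \<le> d"
      using column_interval[OF moon] x set_xs by blast
    from rows_over_under_eq[OF ys(2) this] show ?thesis by (simp add: ys)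
  qed
  \<comment> \<open>The window of a column has one position for each of its rows outside
    \<open>A\<close>. This produces the first two terms of \<open>h\<close>.\<close>
  have col_size: "int (card (rows P - A)) - int (?p (col_coord P i)) - int (?r (col_coord P i)) =
      int (col_len P i) - int (a i)" if i: "i \<in> {1..m}" for i
  proof -
    have "col_coord P i \<in> set xs" using i bij_coord set_xs by (auto dest: bij_betwE)
    note window_size[OF this]
    moreover have "col P i \<subseteq> rows P" by (force simp: col_def column_def rows_def)
    then have "(rows P - A) \<inter> col P i = col P i - A \<inter> col P i" by auto
    then have "card ((rows P - A) \<inter> col P i) + a i = col_len P i"
      using card_Diff_subset[of "A \<inter> col P i" "col P i"] finite_column[OF moon] a[OF i]
        card_mono[of "col P i" "A \<inter> col P i"]
      by (simp add: col_len_def col_def)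
    ultimately show ?thesis by (simp add: col_def)
  qed
  have "(\<Sum>M\<in>fillings P s A. q_indet powi maj P M) =
      (\<Sum>w\<in>col_words ?p ?r t xs (length ys). q_indet powi col_stat ?p ?r xs w)"
  proof (rule sum_fillings_eq_sum_col_words[OF moon A ys(1,2) set_xs])
    fix M assume M: "M \<subseteq> P" "one_per_row M" "snd ` M = set ys"
    have "nonempty_rows M = ys" using M(3) ys(2) by (intro nonempty_rows_unique) auto
    then show "q_indet powi maj P M = q_indet powi col_stat ?p ?r xs (row_word M ys)"
      using maj_eq_col_stat[OF moon M(2,1) dist sorted_column set_xs] by simp
  qed (use t m in auto)
  also have "\<dots> = (\<Prod>j<length xs. q_binomial q_indet (int (length ys) - int (?p (xs ! j)) -
      int (?r (xs ! j)) - int (\<Sum>l<j. t (xs ! l))) (t (xs ! j)))"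
  proof (rule sum_col_words[OF extremal sorted_pr])
    show "\<forall>x\<in>set xs. ?p x + ?r x \<le> length ys" using window_size ys(3) by fastforce
    have "sum_list (map t xs) = sum t (fst ` P)"
      using dist set_xs by (metis sum_list_distinct_conv_sum_set)
    also have "\<dots> = (\<Sum>i=1..m. t (col_coord P i))" by (rule sum.reindex_bij_betw[OF bij_coord, symmetric])
    also have "\<dots> = (\<Sum>i=1..m. s i)" using t by simp
    finally show "length ys \<le> sum_list (map t xs)" using card_le ys(3) by simp
  qed
  also have "\<dots> = (\<Prod>j<m. q_binomial q_indet (h (\<iota> (Suc j))) (s (\<iota> (Suc j))))"
  proof (rule prod.cong)
    fix j assume "j \<in> {..<m}"
    then have j: "j < m" by simp
    have \<iota>j: "\<iota> (Suc l) \<in> {1..m}" if "l \<le> j" for l using \<iota>[of "Suc l"] j that by auto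
    have "(\<Sum>l<j. t (xs ! l)) = (\<Sum>l<j. s (\<iota> (Suc l)))"
      using j t \<iota>j by (intro sum.cong) (auto simp: nth)
    also have "\<dots> = (\<Sum>l=1..<Suc j. s (\<iota> l))"
      using sum.atLeast_Suc_lessThan_Suc_shift[of "\<lambda>l. s (\<iota> l)" 0 j]
      by (simp add: lessThan_atLeast0 o_def del: sum.op_ivl_Suc)
    finally have "int (length ys) - int (?p (xs ! j)) - int (?r (xs ! j)) - int (\<Sum>l<j. t (xs ! l)) =
        h (\<iota> (Suc j))"
      using h[of "Suc j"] col_size[OF \<iota>j[OF order_refl]] j by (simp add: nth ys(3))
    then show "q_binomial q_indet (int (length ys) - int (?p (xs ! j)) - int (?r (xs ! j)) -
        int (\<Sum>l<j. t (xs ! l))) (t (xs ! j)) = q_binomial q_indet (h (\<iota> (Suc j))) (s (\<iota> (Suc j)))"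
      using j t[OF \<iota>j[OF order_refl]] by (simp add: nth)
  qed (simp add: xs_def)
  \<comment> \<open>The factors appear in the order \<open>col_prec\<close>; reindexing along
    \<iota> turns the product into one over column numbers.\<close>
  also have "\<dots> = (\<Prod>i=1..m. q_binomial q_indet (h i) (s i))"
    using prod.reindex_bij_betw[OF bij_betw_trans[OF bij_Suc bij],
        of "\<lambda>i. q_binomial q_indet (h i) (s i)"]
    by (simp add: o_def)
  finally show ?thesis .
qed

end
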